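(* Let $G=\mathrm{GL}_n(F)$, let $K=\mathrm{O}_n(F)=\{g\in G: g^Tg=1_n\}$, and let $B\subset G$ be the Iwahori subgroup. The map $w\mapsto Kg_wB$ is a bijection from $\mathsf{eSymAPM}_n$ to $K\backslash G/B$, where $g_w\in G$ is the explicit matrix attached to $w$ defined in the context.
   Context: $n$ is a positive integer. $\mathbb{K}$ is a quadratically closed field, i.e. a field of characteristic not equal to $2$ in which every element has a square root; fix $i=\sqrt{-1}\in\mathbb{K}$. $F=\mathbb{K}((t))$ and $A=\mathbb{K}[[t]]$. $1_n$ is the $n\times n$ identity matrix. The Iwahori subgroup $B$ is the subgroup of $\mathrm{GL}_n(A)$ consisting of the matrices that become upper triangular upon setting $t=0$. A monomial matrix is a square matrix with exactly one non-zero entry in each row and column. An affine permutation matrix is an $n\times n$ monomial matrix over $F$ whose non-zero entries are integral powers of $t$. $\mathsf{eSymAPM}_n$ is the set of symmetric $n\times n$ affine permutation matrices for which the sum of the exponents of $t$ over all non-zero entries is even. For such $w$, write $\bar w\in S_n$ for the underlying permutation (an involution) and $c_j\in\mathbb{Z}$ for the exponents, so that the non-zero entry in column $j$ is $t^{c_j}$, in row $\bar w(j)$; by symmetry $c_{\bar w(j)}=c_j$. Fix a square root $(t-1)^{1/2}\in A$ of $t-1$. The number of indices $j$ with $\bar w(j)=j$ and $c_j$ odd is even; for each $w$ fix a pairing of these indices into pairs $\{j,k\}$ with $j<k$. The matrix $g_w\in\mathrm{GL}_n(F)$ is obtained from $w$ by the following replacements (all other entries being zero): (i) if $\bar w(j)=j$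 and $c_j$ is even, the $(j,j)$ entry $t^{c_j}$ is replaced with $t^{c_j/2}$; (ii) for each chosen pair $j<k$ of fixed points of $\bar w$ with $c_j=a$, $c_k=b$ odd, the $2\times2$ submatrix in rows and columns $\{j,k\}$ is replaced with $$\begin{pmatrix} t^{\frac{a-1}{2}} & -(t-1)^{\frac12}t^{\frac{b-1}{2}}\\ t^{\frac{a-1}{2}}(t-1)^{\frac12} & t^{\frac{b-1}{2}}\end{pmatrix};$$ (iii) for each $2$-cycle $(j\,k)$ of $\bar w$ with $j<k$ and $c_j=c_k=a$, the $2\times 2$ submatrix in rows and columns $\{j,k\}$ is replaced with $$\begin{pmatrix} i & -i\,t^a/2\\ 1 & t^a/2\end{pmatrix}.$$ *)

theory Defs
  imports "HOL-Analysis.Analysis" "HOL-Computational_Algebra.Formal_Laurent_Series"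
begin

text \<open>
  Matrices over \<open>F = K((t))\<close> have type \<^typ>\<open>'k fls ^ 'n ^ 'n\<close>, where the finite linearly ordered
  index type \<open>'n\<close> plays the role of \<open>{1, \<dots>, n}\<close>; \<open>M $ r $ c\<close> is the entry in row \<open>r\<close> and
  column \<open>c\<close>. The variable \<open>t\<close> is \<^term>\<open>fls_X\<close>, and \<open>A = K[[t]]\<close> is \<^typ>\<open>'k fps\<close>, embedded
  in \<open>F\<close> by \<^const>\<open>fps_to_fls\<close>.
\<close>

definition GL_group :: "('k::field fls ^ 'n ^ 'n) set"
  where "GL_group = {g. invertible g}"

definition O_group :: "('k::field fls ^ 'n ^ 'n) set"
  where "O_group = {g \<in> GL_group. transpose g ** g = mat 1}"

text \<open>
  Invertibility of \<open>b\<close> below is over the ring \<^typ>\<open>'k fps\<close>, so that \<open>b\<close> ranges over \<open>GL\<^sub>n(A)\<close>.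
\<close>

definition Iwahori :: "('k::field fls ^ 'n::{finite,linorder} ^ 'n::{finite,linorder}) set"
  where "Iwahori = map_matrix fps_to_fls `
    {b. invertible b \<and> (\<forall>r c. c < r \<longrightarrow> fps_nth (b $ r $ c) 0 = 0)}"

definition double_coset ::
    "('a::semiring_1 ^ 'n ^ 'n) set \<Rightarrow> 'a ^ 'n ^ 'n \<Rightarrow> ('a ^ 'n ^ 'n) set \<Rightarrow> ('a ^ 'n ^ 'n) set"
  where "double_coset H g L = {h ** g ** l | h l. h \<in> H \<and> l \<in> L}"

definition double_cosets ::
    "('a::semiring_1 ^ 'n ^ 'n) set \<Rightarrow> ('a ^ 'n ^ 'n) set \<Rightarrow> ('a ^ 'n ^ 'n) set \<Rightarrow>
     ('a ^ 'n ^ 'n) set set"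
  where "double_cosets H G L = (\<lambda>g. double_coset H g L) ` G"

definition monomial_matrix :: "'a::zero ^ 'n ^ 'n \<Rightarrow> bool"
  where "monomial_matrix M \<longleftrightarrow>
    (\<forall>r. \<exists>!c. M $ r $ c \<noteq> 0) \<and> (\<forall>c. \<exists>!r. M $ r $ c \<noteq> 0)"

definition affine_perm_matrix :: "'k::field fls ^ 'n ^ 'n \<Rightarrow> bool"
  where "affine_perm_matrix w \<longleftrightarrow> monomial_matrix w \<and>
    (\<forall>r c. w $ r $ c \<noteq> 0 \<longrightarrow> (\<exists>e::int. w $ r $ c = fls_X powi e))"

text \<open>
  \<open>apm_perm w j\<close> and \<open>apm_exp w j\<close> are the row and the \<open>t\<close>-exponent of the non-zero entry in
  column \<open>j\<close> of an affine permutation matrix; they are meaningless for other matrices.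
\<close>

definition apm_perm :: "'k::field fls ^ 'n ^ 'n \<Rightarrow> 'n \<Rightarrow> 'n"
  where "apm_perm w j = (THE r. w $ r $ j \<noteq> 0)"

definition apm_exp :: "'k::field fls ^ 'n ^ 'n \<Rightarrow> 'n \<Rightarrow> int"
  where "apm_exp w j = (THE e. w $ apm_perm w j $ j = fls_X powi e)"

definition eSymAPM :: "('k::field fls ^ 'n ^ 'n) set"
  where "eSymAPM = {w. affine_perm_matrix w \<and> transpose w = w \<and> even (\<Sum>j\<in>UNIV. apm_exp w j)}"

definition odd_fixed_points :: "'k::field fls ^ 'n ^ 'n \<Rightarrow> 'n set"
  where "odd_fixed_points w = {j. apm_perm w j = j \<and> odd (apm_exp w j)}"

text \<open>A pairing is recorded as the set of its pairs, each listed in increasing order.\<close>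

definition is_pairing :: "'n::linorder set \<Rightarrow> ('n \<times> 'n) set \<Rightarrow> bool"
  where "is_pairing S P \<longleftrightarrow>
    P \<subseteq> {(j, k). j \<in> S \<and> k \<in> S \<and> j < k} \<and>
    (\<forall>x\<in>S. \<exists>!p. p \<in> P \<and> (x = fst p \<or> x = snd p))"

text \<open>
  The matrix \<open>g\<^sub>w\<close>, column by column, where \<open>im\<close>, \<open>s\<close> and \<open>P\<close> are the chosen \<open>\<surd>-1 \<in> K\<close>,
  \<open>(t-1)\<^bsup>1/2\<^esup> \<in> A\<close> and pairing of the odd fixed points of \<open>w\<close>. The four outer cases are: an even
  fixed point; an odd fixed point, which is the first or the second member of its pair; the
  smaller, and the larger, element of a 2-cycle.
\<close>

definition g_matrix ::
    "'k::field \<Rightarrow> 'k fps \<Rightarrow> ('n \<times> 'n) set \<Rightarrow>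
     'k fls ^ 'n::{finite,linorder} ^ 'n::{finite,linorder} \<Rightarrow>
     'k fls ^ 'n::{finite,linorder} ^ 'n::{finite,linorder}"
  where "g_matrix im s P w = (\<chi> r c.
    let a = apm_exp w c; c' = apm_perm w c in
    if c' = c \<and> even a then
      (if r = c then fls_X powi (a div 2) else 0)
    else if c' = c then
      (if r = c then fls_X powi ((a - 1) div 2)
       else if (c, r) \<in> P then fls_X powi ((a - 1) div 2) * fps_to_fls s
       else if (r, c) \<in> P then - fps_to_fls s * fls_X powi ((a - 1) div 2)
       else 0)
    else if c < c' then
      (if r = c then fls_const im else if r = c' then 1 else 0)
    else
      (if r = c' then - fls_const im * fls_X powi a / 2 else if r = c then fls_X powi a / 2 else 0))"

end

theory Submission
  imports Defs
begin

text \<open>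
  Write \<open>B\<close> for the Iwahori subgroup. Two invertible matrices have the same Gram matrix
  \<open>g\<^sup>T g\<close> if and only if they lie in the same coset \<open>O\<^sub>n(F) g\<close>
  (\<open>same_gram_matrix\<close>), and replacing \<open>g\<close> by \<open>g b\<close> replaces \<open>S = g\<^sup>T g\<close> by the congruent matrix
  \<open>b\<^sup>T S b\<close>. So the double cosets correspond to the \<open>B\<close>-congruence classes of the
  matrices \<open>g\<^sup>T g\<close>, and since \<open>g\<^sub>w\<^sup>T g\<^sub>w = w\<close> (\<open>transpose_g_matrix_mult\<close>), the claim is that every
  such class contains exactly one element of \<open>eSymAPM\<close>.

  Uniqueness (\<open>congruent_perm_matrices_eq\<close>): if \<open>w' = b\<^sup>T w b\<close>, then \<open>w' b\<inverse> = b\<^sup>T w\<close>. Comparing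
  the valuations of one entry in each column of this equation, and of \<open>w b = (b\<inverse>)\<^sup>T w'\<close>, shows that
  \<open>w\<close> and \<open>w'\<close> have the same exponents; triangularity modulo \<open>t\<close> then shows that their
  permutations are equal.

  Existence (\<open>congruent_reduced\<close>): a symmetric invertible matrix is reduced by simultaneous row and
  column operations from \<open>B\<close>. The pivot is an entry of least valuation, as far up and then as far
  left as possible; this makes the required operations admissible. A diagonal pivot splits off a
  block of size one, which is scaled to a power of \<open>t\<close> by a square root of a unit; an off-diagonal
  pivot splits off a hyperbolic plane, whose isotropic vectors are found by solving a quadratic
  equation. Both use that the units of \<open>K[[t]]\<close> are squares, because \<open>K\<close> is quadratically closed and
  \<open>2\<close> is invertible. If the matrix is \<open>g\<^sup>T g\<close>, the exponents of the
  result have an even sum because its determinant is the square of \<open>det (g b)\<close>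
  (\<open>gram_congruent_eSymAPM\<close>).
\<close>

(* "$" is kept for entries of vectors and matrices; "$$" gives coefficients of Laurent series. *)
no_notation fps_nth (infixl "$" 75)
notation fls_nth (infixl "$$" 75)

(* Powers of t stay in the form "fls_X powi e" instead of being rewritten to shifts of 1. *)
declare fls_X_power_int [simp del]


section \<open>Valuations of Laurent series\<close>

text \<open>\<open>vge m x\<close> says that \<open>x \<in> t\<^sup>m A\<close>, i.e. that the \<open>t\<close>-adic valuation of \<open>x\<close> is at
  least \<open>m\<close> (with \<open>0\<close> of infinite valuation).\<close>

definition vge :: "int \<Rightarrow> 'a::zero fls \<Rightarrow> bool"
  where "vge m x \<longleftrightarrow> (\<forall>k<m. x $$ k = 0)"

lemma vge_iff_subdegree: "vge m x \<longleftrightarrow> x = 0 \<or> m \<le> fls_subdegree x"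
  unfolding vge_def by (metis fls_eq0_below_subdegree fls_subdegree_geI fls_zero_nth linorder_not_le
      nth_fls_subdegree_nonzero order_less_le_trans)

lemma vge_zero [simp]: "vge m 0"
  by (simp add: vge_def)

lemma vge_one [simp]: "vge 0 (1 :: 'a::field fls)"
  by (simp add: vge_def)

lemma vge_add: "vge m x \<Longrightarrow> vge m y \<Longrightarrow> vge m (x + y :: 'a::field fls)"
  by (simp add: vge_def)

lemma vge_diff: "vge m x \<Longrightarrow> vge m y \<Longrightarrow> vge m (x - y :: 'a::field fls)"
  by (simp add: vge_def)

lemma vge_uminus: "vge m x \<Longrightarrow> vge m (- x :: 'a::field fls)"
  by (simp add: vge_def)

lemma vge_sum: "(\<And>i. i \<in> I \<Longrightarrow> vge m (f i)) \<Longrightarrow> vge m (\<Sum>i\<in>I. f i :: 'a::field fls)"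
  by (induction I rule: infinite_finite_induct) (auto intro: vge_add)

lemma vge_mono: "vge m x \<Longrightarrow> n \<le> m \<Longrightarrow> vge n x"
  by (auto simp: vge_def)

lemma vge_mult: "vge m x \<Longrightarrow> vge n y \<Longrightarrow> vge (m + n) (x * y :: 'a::field fls)"
  by (cases "x = 0"; cases "y = 0") (auto simp: vge_iff_subdegree)

lemma vge_mult_le: "vge m x \<Longrightarrow> vge n y \<Longrightarrow> k \<le> m + n \<Longrightarrow> vge k (x * y :: 'a::field fls)"
  using vge_mult vge_mono by blast

lemma vge_Suc: "vge m x \<Longrightarrow> x $$ m = 0 \<Longrightarrow> vge (m + 1) x"
  unfolding vge_def by (metis zless_add1_eq)

lemma vge_nth_eq_0: "vge m x \<Longrightarrow> k < m \<Longrightarrow> x $$ k = 0"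
  by (auto simp: vge_def)

lemma nth_mult_lowest:
  fixes x y :: "'a::field fls"
  assumes "vge m x" "vge n y"
  shows "(x * y) $$ (m + n) = x $$ m * y $$ n"
proof (cases "x $$ m = 0 \<or> y $$ n = 0")
  case True
  then have "vge (m + n + 1) (x * y)"
    using assms vge_Suc[of m x] vge_Suc[of n y] vge_mult[of "m + 1" x n y] vge_mult[of m x "n + 1" y]
    by (auto simp: algebra_simps)
  then show ?thesis
    using True by (auto simp: vge_def)
next
  case False
  then have "fls_subdegree x = m" "fls_subdegree y = n"
    using assms by (auto intro!: fls_subdegree_eqI simp: vge_def)
  then show ?thesis
    using fls_times_base[of x y] by simp
qed

lemma subdegree_eq_of_vge: "vge m x \<Longrightarrow> x $$ m \<noteq> 0 \<Longrightarrow> fls_subdegree x = m"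
  by (auto intro!: fls_subdegree_eqI simp: vge_def)

lemma vge_divide:
  fixes x y :: "'a::field fls"
  assumes "vge m x" "vge n y" "y $$ n \<noteq> 0" "k + n \<le> m"
  shows "vge k (x / y)"
proof -
  have "fls_subdegree y = n"
    using assms by (simp add: subdegree_eq_of_vge)
  then have "vge (- n) (inverse y)"
    by (simp add: vge_iff_subdegree fls_inverse_subdegree)
  then have "vge k (x * inverse y)"
    using assms(1,4) by (auto intro: vge_mult_le)
  then show ?thesis
    by (simp add: field_simps)
qed

lemma vge_fps_to_fls [simp]: "vge 0 (fps_to_fls f :: 'a::field fls)"
  by (simp add: vge_def)

lemma fps_to_fls_regpart: "vge 0 x \<Longrightarrow> fps_to_fls (fls_regpart x) = (x :: 'a::field fls)"
  by (auto simp: vge_def fls_eq_iff)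

lemma fls_X_powi_nth: "(fls_X powi e :: 'a::field fls) $$ k = (if k = e then 1 else 0)"
  by (simp add: fls_X_power_int)

lemma fls_X_powi_inject [simp]: "(fls_X powi e :: 'a::field fls) = fls_X powi f \<longleftrightarrow> e = f"
  by (metis fls_X_powi_nth one_neq_zero)

lemma vge_X_powi: "n \<le> e \<Longrightarrow> vge n (fls_X powi e :: 'a::field fls)"
  by (simp add: vge_def fls_X_powi_nth)


section \<open>Square roots\<close>

text \<open>The coefficients of the square root of \<open>a\<close> with constant term \<open>q\<^sub>0\<close>, solved for one by one;
  this only divides by \<open>2 q\<^sub>0\<close>.\<close>

fun sqrt_coeff :: "(nat \<Rightarrow> 'a::field) \<Rightarrow> 'a \<Rightarrow> nat \<Rightarrow> 'a"
  where "sqrt_coeff a q\<^sub>0 n =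
    (if n = 0 then q\<^sub>0
     else (a n - (\<Sum>i\<in>{1..<n}. sqrt_coeff a q\<^sub>0 i * sqrt_coeff a q\<^sub>0 (n - i))) / (2 * q\<^sub>0))"

declare sqrt_coeff.simps [simp del]

lemma fps_sqrt_exists:
  fixes a :: "'a::field fps"
  assumes "(2 :: 'a) \<noteq> 0" "q\<^sub>0 ^ 2 = fps_nth a 0" "q\<^sub>0 \<noteq> 0"
  obtains q where "q ^ 2 = a" "fps_nth q 0 = q\<^sub>0"
proof
  define c where "c = sqrt_coeff (fps_nth a) q\<^sub>0"
  have c0: "c 0 = q\<^sub>0"
    by (simp add: c_def sqrt_coeff.simps)
  have "(\<Sum>i=0..n. c i * c (n - i)) = fps_nth a n" for n
  proof (cases "n = 0")
    case True
    then show ?thesis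
      using assms(2) c0 by (simp add: power2_eq_square)
  next
    case False
    have "{0..n} = insert 0 (insert n {1..<n})"
      using False by auto
    then have "(\<Sum>i=0..n. c i * c (n - i)) = c 0 * c n + (c n * c 0 + (\<Sum>i\<in>{1..<n}. c i * c (n - i)))"
      using False by simp
    also have "c n = (fps_nth a n - (\<Sum>i\<in>{1..<n}. c i * c (n - i))) / (2 * q\<^sub>0)"
      unfolding c_def using False by (subst sqrt_coeff.simps) simp
    finally show ?thesis
      using assms(1,3) c0 by (simp add: field_simps)
  qed
  then show "(Abs_fps c) ^ 2 = a"
    by (simp add: fps_eq_iff power2_eq_square fps_mult_nth)
  show "fps_nth (Abs_fps c) 0 = q\<^sub>0"
    by (simp add: c0)
qed

lemma fls_sqrt_exists:
  fixes x :: "'a::field fls"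
  assumes "(2 :: 'a) \<noteq> 0" "vge (2 * m) x" "y ^ 2 = x $$ (2 * m)" "y \<noteq> 0"
  obtains q where "q ^ 2 = x" "vge m q" "q $$ m = y"
proof -
  define z where "z = fls_shift (2 * m) x"
  have z: "vge 0 z" "z $$ 0 = y ^ 2"
    using assms(2,3) by (auto simp: z_def vge_def)
  obtain q where q: "q ^ 2 = fls_regpart z" "fps_nth q 0 = y"
    using fps_sqrt_exists[of y "fls_regpart z"] assms(1,4) z(2) by auto
  have "fps_to_fls q ^ 2 = z"
    using q(1) fps_to_fls_regpart[OF z(1)] by (simp flip: fps_to_fls_power)
  then have "(fls_shift (- m) (fps_to_fls q)) ^ 2 = x"
    by (simp add: z_def power2_eq_square fls_times_both_shifted_simp)
  then show ?thesis
    using that[of "fls_shift (- m) (fps_to_fls q)"] q(2) by (simp add: vge_def)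
qed


section \<open>The Iwahori subgroup\<close>

lemma fps_to_fls_sum: "fps_to_fls (\<Sum>i\<in>I. f i :: 'a::field fps) = (\<Sum>i\<in>I. fps_to_fls (f i))"
  by (induction I rule: infinite_finite_induct) auto

lemma map_matrix_fps_to_fls_mult:
  fixes A B :: "'a::field fps ^ 'n ^ 'n"
  shows "map_matrix fps_to_fls (A ** B) = map_matrix fps_to_fls A ** map_matrix fps_to_fls B"
  by (simp add: vec_eq_iff matrix_matrix_mult_def fps_to_fls_sum fls_times_fps_to_fls)

lemma map_matrix_fps_to_fls_mat_1:
  "map_matrix fps_to_fls (mat 1 :: 'a::field fps ^ 'n ^ 'n) = mat 1"
  by (simp add: vec_eq_iff mat_def)

lemma map_matrix_fps_to_fls_inject:
  fixes A B :: "'a::field fps ^ 'n ^ 'n"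
  shows "map_matrix fps_to_fls A = map_matrix fps_to_fls B \<longleftrightarrow> A = B"
  by (simp add: vec_eq_iff)

text \<open>The Iwahori subgroup described inside \<open>GL\<^sub>n(F)\<close> by valuations.\<close>

lemma Iwahori_iff:
  fixes b :: "'k::field fls ^ 'n::{finite,linorder} ^ 'n::{finite,linorder}"
  shows "b \<in> Iwahori \<longleftrightarrow>
    (\<forall>i j. vge 0 (b $ i $ j)) \<and> (\<forall>i j. j < i \<longrightarrow> vge 1 (b $ i $ j)) \<and>
    (\<exists>b'. b ** b' = mat 1 \<and> b' ** b = mat 1 \<and> (\<forall>i j. vge 0 (b' $ i $ j)))"
    (is "_ \<longleftrightarrow> ?integral b \<and> ?upper b \<and> (\<exists>b'. ?inverse b')")
proof
  assume "b \<in> Iwahori"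
  then obtain c where c: "b = map_matrix fps_to_fls c" "invertible c"
    "\<forall>r s. s < r \<longrightarrow> fps_nth (c $ r $ s) 0 = 0"
    by (auto simp: Iwahori_def)
  then obtain c' where "c ** c' = mat 1" "c' ** c = mat 1"
    by (auto simp: invertible_def)
  then have "?inverse (map_matrix fps_to_fls c')"
    by (simp add: c(1) map_matrix_fps_to_fls_mat_1 flip: map_matrix_fps_to_fls_mult)
  moreover have "?integral b" "?upper b"
    using c(1,3) by (auto simp: vge_def)
  ultimately show "?integral b \<and> ?upper b \<and> (\<exists>b'. ?inverse b')"
    by blast
next
  assume b: "?integral b \<and> ?upper b \<and> (\<exists>b'. ?inverse b')"
  then obtain b' where b': "?inverse b'"
    by blast
  define c where "c = map_matrix fls_regpart b"
  define c' where "c' = map_matrix fls_regpart b'"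
  have c: "b = map_matrix fps_to_fls c" and c': "b' = map_matrix fps_to_fls c'"
    using b b' by (simp_all add: c_def c'_def vec_eq_iff fps_to_fls_regpart)
  have "invertible c"
    using b' unfolding c c' invertible_def
    by (metis map_matrix_fps_to_fls_inject map_matrix_fps_to_fls_mat_1 map_matrix_fps_to_fls_mult)
  moreover have "\<forall>r s. s < r \<longrightarrow> fps_nth (c $ r $ s) 0 = 0"
    using b by (auto simp: c_def vge_def)
  ultimately show "b \<in> Iwahori"
    by (auto simp: Iwahori_def c)
qed

lemma Iwahori_integral: "b \<in> Iwahori \<Longrightarrow> vge 0 (b $ i $ j)"
  by (simp add: Iwahori_iff)

lemma Iwahori_upper: "b \<in> Iwahori \<Longrightarrow> j < i \<Longrightarrow> vge 1 (b $ i $ j)"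
  by (simp add: Iwahori_iff)

lemma matrix_mult_nth: "(A ** B) $ i $ j = (\<Sum>k\<in>UNIV. A $ i $ k * B $ k $ j)"
  by (simp add: matrix_matrix_mult_def)

lemma mat_1_nth: "mat 1 $ i $ j = (if i = j then 1 else 0)"
  by (simp add: mat_def)

lemma finite_linorder_downward_induct:
  fixes i :: "'n::{finite,linorder}"
  assumes "\<And>i. (\<And>k. i < k \<Longrightarrow> Q k) \<Longrightarrow> Q i"
  shows "Q i"
proof (induction "card {k. i < k}" arbitrary: i rule: less_induct)
  case less
  have "card {l. k < l} < card {l. i < l}" if "i < k" for k
    using that by (intro psubset_card_mono) auto
  then show ?case
    using less assms by blast
qed

text \<open>Modulo \<open>t\<close> this is the statement that the inverse of an upper triangular matrix is upper
  triangular and that the diagonal entries are invertible.\<close>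

lemma Iwahori_inverse:
  fixes b :: "'k::field fls ^ 'n::{finite,linorder} ^ 'n::{finite,linorder}"
  assumes "b \<in> Iwahori"
  obtains b' where "b' \<in> Iwahori" "b ** b' = mat 1" "b' ** b = mat 1"
    "\<And>i. b $ i $ i $$ 0 \<noteq> 0"
proof -
  obtain b' where b': "b ** b' = mat 1" "b' ** b = mat 1" "\<And>i j. vge 0 (b' $ i $ j)"
    using assms unfolding Iwahori_iff by blast
  have "b $ i $ i $$ 0 \<noteq> 0 \<and> (\<forall>j<i. b' $ i $ j $$ 0 = 0)" for i
  proof (induction i rule: finite_linorder_downward_induct)
    case (1 i)
    have expand: "mat 1 $ i $ j $$ 0 = b $ i $ i $$ 0 * b' $ i $ j $$ 0" if "j \<le> i" for j
    proof -
      have "(b $ i $ k * b' $ k $ j) $$ 0 = b $ i $ k $$ 0 * b' $ k $ j $$ 0" for k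
        using nth_mult_lowest[of 0 "b $ i $ k" 0] Iwahori_integral[OF assms] b'(3) by simp
      then have "mat 1 $ i $ j $$ 0 = (\<Sum>k\<in>UNIV. b $ i $ k $$ 0 * b' $ k $ j $$ 0)"
        by (simp add: matrix_mult_nth fls_nth_sum flip: b'(1))
      also have "\<dots> = (\<Sum>k\<in>{i}. b $ i $ k $$ 0 * b' $ k $ j $$ 0)"
      proof (rule sum.mono_neutral_right)
        show "\<forall>k\<in>UNIV - {i}. b $ i $ k $$ 0 * b' $ k $ j $$ 0 = 0"
        proof
          fix k assume "k \<in> UNIV - {i}"
          then consider "k < i" | "i < k"
            by fastforce
          then show "b $ i $ k $$ 0 * b' $ k $ j $$ 0 = 0"
          proof cases
            case 1
            then show ?thesis
              using vge_nth_eq_0[OF Iwahori_upper[OF assms \<open>k < i\<close>]] by simp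
          next
            case 2
            then show ?thesis
              using 1 that by simp
          qed
        qed
      qed auto
      finally show ?thesis
        by simp
    qed
    have "b $ i $ i $$ 0 \<noteq> 0"
      using expand[of i] by (auto simp: mat_def)
    moreover have "b' $ i $ j $$ 0 = 0" if "j < i" for j
      using expand[OF less_imp_le[OF that]] that \<open>b $ i $ i $$ 0 \<noteq> 0\<close> by (auto simp: mat_1_nth split: if_splits)
    ultimately show ?case
      by blast
  qed
  note triangular = this
  have "b' \<in> Iwahori"
    unfolding Iwahori_iff
  proof (intro conjI allI impI exI[of _ b])
    show "vge 1 (b' $ i $ j)" if "j < i" for i j
      using triangular that b'(3) vge_Suc[of 0 "b' $ i $ j"] by simp
  qed (use b' Iwahori_integral[OF assms] in auto)
  then show ?thesis
    using that b' triangular by blast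
qed

lemma Iwahori_mult:
  assumes "a \<in> Iwahori" "b \<in> Iwahori"
  shows "a ** b \<in> Iwahori"
proof -
  obtain a' where a': "a' \<in> Iwahori" "a ** a' = mat 1" "a' ** a = mat 1"
    using Iwahori_inverse[OF assms(1)] by metis
  obtain b' where b': "b' \<in> Iwahori" "b ** b' = mat 1" "b' ** b = mat 1"
    using Iwahori_inverse[OF assms(2)] by metis
  have integral: "vge 0 ((c ** d) $ i $ j)" if "c \<in> Iwahori" "d \<in> Iwahori"
    for c d :: "'a fls ^ 'b::{finite,linorder} ^ 'b::{finite,linorder}" and i j
    unfolding matrix_mult_nth
    using that by (intro vge_sum vge_mult_le[of 0 _ 0]) (auto intro: Iwahori_integral)
  show ?thesis
    unfolding Iwahori_iff
  proof (intro conjI allI impI exI[of _ "b' ** a'"])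
    show "(a ** b) ** (b' ** a') = mat 1"
      by (metis a'(2) b'(2) matrix_mul_assoc matrix_mul_lid)
    show "(b' ** a') ** (a ** b) = mat 1"
      by (metis a'(3) b'(3) matrix_mul_assoc matrix_mul_lid)
    show "vge 1 ((a ** b) $ i $ j)" if "j < i" for i j
      unfolding matrix_mult_nth
    proof (intro vge_sum)
      fix k
      show "vge 1 (a $ i $ k * b $ k $ j)"
      proof (cases "k < i")
        case True
        then show ?thesis
          using assms by (intro vge_mult_le[of 1 _ 0]) (auto intro: Iwahori_integral Iwahori_upper)
      next
        case False
        then show ?thesis
          using assms \<open>j < i\<close>
          by (intro vge_mult_le[of 0 _ 1]) (auto intro: Iwahori_integral Iwahori_upper)
      qed
    qed
  qed (use assms a' b' integral in auto)
qed

lemma mat_1_in_Iwahori: "mat 1 \<in> Iwahori"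
  unfolding Iwahori_iff by (auto simp: mat_1_nth intro!: exI[of _ "mat 1"])


section \<open>Uniqueness of the affine permutation matrix in a congruence class\<close>

text \<open>The matrix whose only non-zero entry in column \<open>j\<close> is \<open>t\<close> to the power \<open>e j\<close>, in row \<open>p j\<close>;
  it is an affine permutation matrix when \<open>p\<close> is a permutation.\<close>

definition perm_matrix :: "('n \<Rightarrow> 'n) \<Rightarrow> ('n \<Rightarrow> int) \<Rightarrow> 'k::field fls ^ 'n ^ 'n"
  where "perm_matrix p e = (\<chi> r c. if r = p c then fls_X powi e c else 0)"

lemma perm_matrix_nth:
  "perm_matrix p e $ r $ c = (if r = p c then fls_X powi e c else 0)"
  by (simp add: perm_matrix_def)

lemma mult_perm_matrix_nth:
  "(A ** perm_matrix p e) $ r $ c = A $ r $ p c * fls_X powi e c"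
  by (simp add: matrix_mult_nth perm_matrix_nth if_distrib cong: if_cong)

lemma perm_matrix_mult_nth:
  assumes "inj p"
  shows "(perm_matrix p e ** A) $ p j $ c = fls_X powi e j * A $ j $ c"
  using assms
  by (simp add: matrix_mult_nth perm_matrix_nth inj_eq if_distrib[of "\<lambda>x. x * _"] cong: if_cong)

text \<open>Comparing the entries in position \<open>(p j, j)\<close> of the two products: on the left its
  valuation is exactly \<open>e j\<close>, and on the right it is at least \<open>f j\<close>, and greater than \<open>f j\<close> if
  \<open>p j < q j\<close>.\<close>

lemma perm_matrix_exp_le:
  fixes b c :: "'k::field fls ^ 'n::{finite,linorder} ^ 'n::{finite,linorder}"
  assumes "inj p" "b \<in> Iwahori" "c \<in> Iwahori"
    and eq: "perm_matrix p e ** b = transpose c ** perm_matrix q f"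
  shows "f j \<le> e j" "f j = e j \<Longrightarrow> q j \<le> p j"
proof -
  have entry: "fls_X powi e j * b $ j $ j = c $ q j $ p j * fls_X powi f j"
    using arg_cong[OF eq, of "\<lambda>M. M $ p j $ j"]
    unfolding perm_matrix_mult_nth[OF assms(1)] mult_perm_matrix_nth by (simp add: transpose_def)
  have "b $ j $ j $$ 0 \<noteq> 0"
    using Iwahori_inverse[OF assms(2)] by metis
  then have nonzero: "(fls_X powi e j * b $ j $ j) $$ e j \<noteq> 0"
    using nth_mult_lowest[of "e j" "fls_X powi e j" 0 "b $ j $ j"] Iwahori_integral[OF assms(2)]
    by (simp add: vge_X_powi fls_X_powi_nth)
  have "vge (f j) (c $ q j $ p j * fls_X powi f j)"
    using Iwahori_integral[OF assms(3)] by (intro vge_mult_le[of 0 _ "f j"]) (auto intro: vge_X_powi)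
  then show "f j \<le> e j"
    using nonzero unfolding entry by (meson linorder_not_le vge_nth_eq_0)
  show "q j \<le> p j" if "f j = e j"
  proof (rule ccontr)
    assume "\<not> q j \<le> p j"
    then have "vge (1 + f j) (c $ q j $ p j * fls_X powi f j)"
      using Iwahori_upper[OF assms(3)] by (intro vge_mult) (auto intro: vge_X_powi)
    then show False
      using nonzero that unfolding entry by (metis vge_nth_eq_0 zless_add1_eq add.commute)
  qed
qed

theorem congruent_perm_matrices_eq:
  fixes b :: "'k::field fls ^ 'n::{finite,linorder} ^ 'n::{finite,linorder}"
  assumes "inj p" "inj q" "b \<in> Iwahori"
    and eq: "perm_matrix q f = transpose b ** perm_matrix p e ** b"
  shows "p = q \<and> e = f"
proof -
  let ?P = "perm_matrix p e :: 'k fls ^ 'n::{finite,linorder} ^ 'n::{finite,linorder}"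
    and ?Q = "perm_matrix q f :: 'k fls ^ 'n::{finite,linorder} ^ 'n::{finite,linorder}"
  obtain b' where b': "b' \<in> Iwahori" "b ** b' = mat 1" "b' ** b = mat 1"
    using Iwahori_inverse[OF assms(3)] by metis
  have "?Q ** b' = transpose b ** ?P"
    unfolding eq by (metis b'(2) matrix_mul_assoc matrix_mul_rid)
  note le1 = perm_matrix_exp_le[OF assms(2) b'(1) assms(3) this]
  have "transpose b' ** transpose b = mat 1"
    by (metis b'(2) matrix_transpose_mul transpose_mat)
  then have "?P ** b = transpose b' ** ?Q"
    unfolding eq by (metis matrix_mul_assoc matrix_mul_lid)
  note le2 = perm_matrix_exp_le[OF assms(1,3) b'(1) this]
  have "e j = f j" for j
    using le1(1) le2(1) by (meson order_antisym)
  then show ?thesis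
    using le1(2) le2(2) by (metis ext order_antisym)
qed


section \<open>Reduction of symmetric matrices by Iwahori congruences\<close>

text \<open>Congruence of matrices under the Iwahori subgroup.\<close>

definition Iwahori_congruent :: "'k::field fls ^ 'n::{finite,linorder} ^ 'n::{finite,linorder} \<Rightarrow>
    'k fls ^ 'n::{finite,linorder} ^ 'n::{finite,linorder} \<Rightarrow> bool"
  where "Iwahori_congruent S S' \<longleftrightarrow> (\<exists>b\<in>Iwahori. S' = transpose b ** S ** b)"

lemma congruent_refl: "Iwahori_congruent S S"
  unfolding Iwahori_congruent_def using mat_1_in_Iwahori
  by (metis matrix_mul_lid matrix_mul_rid transpose_mat)

lemma congruent_trans: "Iwahori_congruent S S' \<Longrightarrow> Iwahori_congruent S' S'' \<Longrightarrow> Iwahori_congruent S S''"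
  unfolding Iwahori_congruent_def by (metis Iwahori_mult matrix_mul_assoc matrix_transpose_mul)

lemma congruent_symmetric: "Iwahori_congruent S S' \<Longrightarrow> transpose S = S \<Longrightarrow> transpose S' = S'"
  by (auto simp: Iwahori_congruent_def matrix_transpose_mul matrix_mul_assoc)

lemma Iwahori_imp_invertible: "b \<in> Iwahori \<Longrightarrow> invertible b"
  by (auto simp: Iwahori_iff invertible_def)

lemma invertible_transpose:
  fixes A :: "'a::comm_semiring_1 ^ 'n ^ 'n"
  shows "invertible A \<Longrightarrow> invertible (transpose A)"
  unfolding invertible_def by (metis matrix_transpose_mul transpose_mat)

lemma congruent_invertible: "Iwahori_congruent S S' \<Longrightarrow> invertible S \<Longrightarrow> invertible S'"
  unfolding Iwahori_congruent_def
  by (metis Iwahori_imp_invertible invertible_mult invertible_transpose)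

lemma symmetric_nth: "transpose S = S \<Longrightarrow> S $ i $ j = S $ j $ i"
  by (metis transpose_def vec_lambda_beta)

lemma matrix_add_rdistrib: "(A + B) ** C = A ** C + B ** (C :: 'a::semiring_1 ^ 'n ^ 'n)"
  by (simp add: vec_eq_iff matrix_mult_nth distrib_right sum.distrib)

text \<open>The congruence by \<open>1 + N\<close>, whose inverse is \<open>1 - N\<close>: first column operations, giving \<open>T\<close>, and then
  the same row operations.\<close>

lemma congruent_unipotent:
  fixes S N :: "'k::field fls ^ 'n::{finite,linorder} ^ 'n::{finite,linorder}"
  assumes "N ** N = 0" "\<And>i j. vge 0 (N $ i $ j)" "\<And>i j. j < i \<Longrightarrow> vge 1 (N $ i $ j)"
  obtains S' T where "Iwahori_congruent S S'"
    "\<And>i j. T $ i $ j = S $ i $ j + (\<Sum>l\<in>UNIV. S $ i $ l * N $ l $ j)"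
    "\<And>i j. S' $ i $ j = T $ i $ j + (\<Sum>k\<in>UNIV. N $ k $ i * T $ k $ j)"
proof -
  define b where "b = mat 1 + N"
  have inverse: "b ** (mat 1 - N) = mat 1" "(mat 1 - N) ** b = mat 1"
  proof -
    have "b ** (mat 1 - N) + b ** N = b" "(mat 1 - N) ** b + N ** b = b"
      by (simp_all flip: matrix_add_ldistrib matrix_add_rdistrib)
    moreover have "b ** N = N" "N ** b = N"
      using assms(1) by (simp_all add: b_def matrix_add_ldistrib matrix_add_rdistrib)
    ultimately show "b ** (mat 1 - N) = mat 1" "(mat 1 - N) ** b = mat 1"
      by (simp_all add: b_def)
  qed
  have "b \<in> Iwahori"
    unfolding Iwahori_iff
    using inverse assms(2,3)
    by (intro conjI allI impI exI[of _ "mat 1 - N"])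
       (auto simp: b_def mat_1_nth intro!: vge_add vge_diff vge_uminus)
  show ?thesis
  proof (rule that)
    show "Iwahori_congruent S (transpose b ** (S ** b))"
      using \<open>b \<in> Iwahori\<close> by (auto simp: Iwahori_congruent_def matrix_mul_assoc)
    show "(S ** b) $ i $ j = S $ i $ j + (\<Sum>l\<in>UNIV. S $ i $ l * N $ l $ j)" for i j
      by (simp add: b_def matrix_add_ldistrib flip: matrix_mult_nth)
    have "transpose b = mat 1 + transpose N"
      by (simp add: b_def transpose_def vec_eq_iff mat_1_nth)
    then show "(transpose b ** (S ** b)) $ i $ j =
        (S ** b) $ i $ j + (\<Sum>k\<in>UNIV. N $ k $ i * (S ** b) $ k $ j)" for i j
      by (simp add: matrix_add_rdistrib) (simp add: matrix_mult_nth[of _ "S ** b"] transpose_def)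
  qed
qed

text \<open>The column operations that add \<open>x k j\<close> times column \<open>k\<close> to column \<open>j\<close>, for all \<open>k \<in> C\<close> and
  \<open>j \<notin> C\<close>, followed by the same row operations. The \<open>x k j\<close> are chosen to make the rows \<open>C\<close>
  vanish outside the columns \<open>C\<close>.\<close>

lemma clear_block:
  fixes S :: "'k::field fls ^ 'n::{finite,linorder} ^ 'n::{finite,linorder}"
  assumes x_integral: "\<And>k j. k \<in> C \<Longrightarrow> j \<notin> C \<Longrightarrow> vge 0 (x k j)"
    and x_upper: "\<And>k j. k \<in> C \<Longrightarrow> j \<notin> C \<Longrightarrow> j < k \<Longrightarrow> vge 1 (x k j)"
    and x_solves: "\<And>k j. k \<in> C \<Longrightarrow> j \<notin> C \<Longrightarrow> S $ k $ j + (\<Sum>l\<in>C. S $ k $ l * x l j) = 0"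
  obtains S' where "Iwahori_congruent S S'"
    "\<And>k j. k \<in> C \<Longrightarrow> j \<notin> C \<Longrightarrow> S' $ k $ j = 0"
    "\<And>k l. k \<in> C \<Longrightarrow> l \<in> C \<Longrightarrow> S' $ k $ l = S $ k $ l"
    "\<And>i j. i \<notin> C \<Longrightarrow> j \<notin> C \<Longrightarrow> (\<And>k. k \<in> C \<Longrightarrow> x k j = 0) \<Longrightarrow> S' $ i $ j = S $ i $ j"
proof -
  define N where "N = (\<chi> k j. if k \<in> C \<and> j \<notin> C then x k j else 0)"
  have N_nth: "N $ k $ j = (if k \<in> C \<and> j \<notin> C then x k j else 0)" for k j
    by (simp add: N_def)
  have "N ** N = 0"
    by (auto simp: vec_eq_iff matrix_mult_nth N_nth intro!: sum.neutral)
  moreover have "vge 0 (N $ i $ j)" "j < i \<Longrightarrow> vge 1 (N $ i $ j)" for i j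
    using x_integral x_upper by (auto simp: N_nth)
  ultimately obtain S' T where S': "Iwahori_congruent S S'"
    and T_nth: "\<And>i j. T $ i $ j = S $ i $ j + (\<Sum>l\<in>UNIV. S $ i $ l * N $ l $ j)"
    and S'_nth: "\<And>i j. S' $ i $ j = T $ i $ j + (\<Sum>k\<in>UNIV. N $ k $ i * T $ k $ j)"
    using congruent_unipotent[of N S] by blast
  have T: "T $ i $ j = S $ i $ j + (if j \<notin> C then \<Sum>l\<in>C. S $ i $ l * x l j else 0)" for i j
  proof -
    have "(\<Sum>l\<in>UNIV. S $ i $ l * N $ l $ j) = (\<Sum>l\<in>C. S $ i $ l * N $ l $ j)"
      by (rule sum.mono_neutral_right) (auto simp: N_nth)
    then show ?thesis
      by (simp add: T_nth N_nth)
  qed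
  then have T_zero: "T $ k $ j = 0" if "k \<in> C" "j \<notin> C" for k j
    using that x_solves by simp
  have S'_eq: "S' $ i $ j = T $ i $ j" if "i \<in> C \<or> j \<notin> C" for i j
  proof -
    have "(\<Sum>k\<in>UNIV. N $ k $ i * T $ k $ j) = 0"
      using that T_zero by (intro sum.neutral) (auto simp: N_nth)
    then show ?thesis
      by (simp add: S'_nth)
  qed
  show ?thesis
    by (rule that[OF S']) (simp_all add: S'_eq T_zero, simp_all add: T)
qed

text \<open>Adding \<open>f\<close> times column \<open>k\<close> to column \<open>l\<close>, and the same for the rows.\<close>

lemma add_column:
  fixes S :: "'k::field fls ^ 'n::{finite,linorder} ^ 'n::{finite,linorder}"
  assumes "k \<noteq> l" "vge 0 f" "l < k \<Longrightarrow> vge 1 f"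
  obtains S' where "Iwahori_congruent S S'"
    "\<And>i j. S' $ i $ j = S $ i $ j + (if j = l then f * S $ i $ k else 0) +
      (if i = l then f * S $ k $ j else 0) + (if i = l \<and> j = l then f\<^sup>2 * S $ k $ k else 0)"
proof -
  define N where "N = (\<chi> i j. if i = k \<and> j = l then f else 0)"
  have N_nth: "N $ i $ j = (if i = k \<and> j = l then f else 0)" for i j
    by (simp add: N_def)
  have "N ** N = 0"
    using assms(1) by (auto simp: vec_eq_iff matrix_mult_nth N_nth intro!: sum.neutral)
  moreover have "vge 0 (N $ i $ j)" "j < i \<Longrightarrow> vge 1 (N $ i $ j)" for i j
    using assms by (auto simp: N_nth)
  ultimately obtain S' T where S': "Iwahori_congruent S S'"
    and T_nth: "\<And>i j. T $ i $ j = S $ i $ j + (\<Sum>h\<in>UNIV. S $ i $ h * N $ h $ j)"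
    and S'_nth: "\<And>i j. S' $ i $ j = T $ i $ j + (\<Sum>h\<in>UNIV. N $ h $ i * T $ h $ j)"
    using congruent_unipotent[of N S] by blast
  have "(\<Sum>h\<in>UNIV. S $ i $ h * N $ h $ j) = (\<Sum>h\<in>{k}. S $ i $ h * N $ h $ j)" for i j
    by (rule sum.mono_neutral_right) (auto simp: N_nth)
  then have T: "T $ i $ j = S $ i $ j + (if j = l then f * S $ i $ k else 0)" for i j
    by (simp add: T_nth N_nth)
  have "(\<Sum>h\<in>UNIV. N $ h $ i * T $ h $ j) = (\<Sum>h\<in>{k}. N $ h $ i * T $ h $ j)" for i j
    by (rule sum.mono_neutral_right) (auto simp: N_nth)
  then have "S' $ i $ j = T $ i $ j + (if i = l then f * T $ k $ j else 0)" for i j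
    by (simp add: S'_nth N_nth)
  then show ?thesis
    by (intro that[OF S']) (simp add: T algebra_simps power2_eq_square)
qed

text \<open>Multiplying column \<open>l\<close> and row \<open>l\<close> by a unit \<open>u\<close> of \<open>A\<close>.\<close>

lemma scale_column:
  fixes S :: "'k::field fls ^ 'n::{finite,linorder} ^ 'n::{finite,linorder}"
  assumes "vge 0 u" "u $$ 0 \<noteq> 0"
  obtains S' where "Iwahori_congruent S S'"
    "\<And>i j. S' $ i $ j = (if i = l then u else 1) * (if j = l then u else 1) * S $ i $ j"
proof -
  define d where "d = (\<lambda>v (j::'n). if j = l then v else 1 :: 'k fls)"
  define diag where "diag v = (\<chi> i j. if i = j then d v j else 0)" for v
  have diag_nth: "diag v $ i $ j = (if i = j then d v j else 0)" for v i j
    by (simp add: diag_def)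
  have mult_diag: "(M ** diag v) $ i $ j = M $ i $ j * d v j" for M :: "'k fls ^ 'n::{finite,linorder} ^ 'n::{finite,linorder}" and v i j
    by (simp add: matrix_mult_nth diag_nth if_distrib cong: if_cong)
  have diag_mult: "(diag v ** M) $ i $ j = d v i * M $ i $ j" for M :: "'k fls ^ 'n::{finite,linorder} ^ 'n::{finite,linorder}" and v i j
    by (simp add: matrix_mult_nth diag_nth if_distrib[of "\<lambda>x. x * _"] cong: if_cong)
  have "u \<noteq> 0"
    using assms(2) by auto
  then have inverse: "diag u ** diag (1 / u) = mat 1" "diag (1 / u) ** diag u = mat 1"
    by (simp_all add: vec_eq_iff mult_diag mat_def) (auto simp: diag_nth d_def)
  have "vge 0 (1 / u)"
    using assms by (intro vge_divide[of 0 _ 0]) auto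
  then have "diag u \<in> Iwahori"
    unfolding Iwahori_iff
    using inverse assms(1)
    by (intro conjI allI impI exI[of _ "diag (1 / u)"]) (auto simp: diag_nth d_def)
  moreover have "transpose (diag u) = diag u"
    by (simp add: transpose_def vec_eq_iff diag_nth)
  ultimately have "Iwahori_congruent S (diag u ** (S ** diag u))"
    by (metis Iwahori_congruent_def matrix_mul_assoc)
  then show ?thesis
    by (rule that) (simp add: diag_mult mult_diag d_def)
qed


text \<open>A block with rows and columns \<open>r < c\<close> in which the off-diagonal entry has the least
  valuation, not attained at \<open>(r, r)\<close>, is a hyperbolic plane. The isotropic vector
  \<open>e\<^sub>r + f e\<^sub>c\<close> comes from the root \<open>f\<close> of the quadratic equation
  \<open>S\<^sub>r\<^sub>r + 2 f S\<^sub>r\<^sub>c + f\<^sup>2 S\<^sub>c\<^sub>c = 0\<close> that is divisible by \<open>t\<close>.\<close>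

lemma normalize_plane:
  fixes S :: "'k::field fls ^ 'n::{finite,linorder} ^ 'n::{finite,linorder}"
  assumes two: "(2 :: 'k) \<noteq> 0"
    and sym: "transpose S = S" and "r < c"
    and isolated: "\<And>k j. k \<in> {r, c} \<Longrightarrow> j \<notin> {r, c} \<Longrightarrow> S $ k $ j = 0"
    and rr: "vge (m + 1) (S $ r $ r)" and cc: "vge m (S $ c $ c)"
    and rc: "vge m (S $ r $ c)" "S $ r $ c $$ m \<noteq> 0"
  obtains S' where "Iwahori_congruent S S'"
    "S' $ r $ r = 0" "S' $ c $ c = 0" "S' $ r $ c = fls_X powi m" "S' $ c $ r = fls_X powi m"
    "\<And>i j. i \<notin> {r, c} \<or> j \<notin> {r, c} \<Longrightarrow> S' $ i $ j = S $ i $ j"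
proof -
  define \<alpha> \<beta> \<gamma> where "\<alpha> = S $ r $ r" and "\<beta> = S $ r $ c" and "\<gamma> = S $ c $ c"
  note block_defs = \<alpha>_def \<beta>_def \<gamma>_def
  have \<beta>: "S $ c $ r = \<beta>"
    using symmetric_nth[OF sym] by (simp add: \<beta>_def)
  have isolated': "S $ j $ k = 0" if "k \<in> {r, c}" "j \<notin> {r, c}" for k j
    using isolated[OF that] symmetric_nth[OF sym] by metis
  have two': "(2 :: 'k fls) \<noteq> 0"
    using two by (metis fls_const_numeral fls_const_0 fls_const_nonzero)
  have \<alpha>\<gamma>: "vge (2 * m + 1) (\<alpha> * \<gamma>)"
    using vge_mult[OF rr cc] by (simp add: block_defs algebra_simps)
  have "vge (2 * m) (\<beta>\<^sup>2)" "\<beta>\<^sup>2 $$ (2 * m) = (\<beta> $$ m)\<^sup>2"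
    using vge_mult[OF rc(1) rc(1)] nth_mult_lowest[OF rc(1) rc(1)]
    by (simp_all add: \<beta>_def power2_eq_square)
  then have "vge (2 * m) (\<beta>\<^sup>2 - \<alpha> * \<gamma>)" "(\<beta>\<^sup>2 - \<alpha> * \<gamma>) $$ (2 * m) = (\<beta> $$ m)\<^sup>2"
    using \<alpha>\<gamma> vge_mono[OF \<alpha>\<gamma>, of "2 * m"] by (auto intro: vge_diff simp: vge_nth_eq_0[OF \<alpha>\<gamma>])
  \<comment> \<open>The root with the same leading coefficient as \<open>\<beta>\<close>, so that \<open>\<beta> + q\<close> has valuation exactly \<open>m\<close>
    and the quadratic formula, written with \<open>\<beta> + q\<close> in the denominator, gives a root in \<open>t A\<close>.\<close>
  then obtain q where q: "q\<^sup>2 = \<beta>\<^sup>2 - \<alpha> * \<gamma>" "vge m q" "q $$ m = \<beta> $$ m"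
    using fls_sqrt_exists[OF two, of m "\<beta>\<^sup>2 - \<alpha> * \<gamma>" "\<beta> $$ m"] rc(2) by (auto simp: \<beta>_def)
  have \<beta>q: "vge m (\<beta> + q)" "(\<beta> + q) $$ m \<noteq> 0"
    using rc q two by (auto simp: \<beta>_def intro: vge_add simp flip: mult_2)
  define f where "f = - \<alpha> / (\<beta> + q)"
  have f: "vge 1 f"
    unfolding f_def using rr \<beta>q by (intro vge_divide[of "m + 1" _ m]) (auto simp: \<alpha>_def vge_uminus)
  have f_root: "\<alpha> + 2 * f * \<beta> + f\<^sup>2 * \<gamma> = 0"
  proof -
    have "\<beta> + q \<noteq> 0"
      using \<beta>q(2) by (metis fls_zero_nth)
    then have "f * (\<beta> + q) = - \<alpha>"
      by (simp add: f_def)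
    moreover have "(\<alpha> + 2 * f * \<beta> + f\<^sup>2 * \<gamma>) * (\<beta> + q)\<^sup>2 =
        \<alpha> * (\<beta> + q)\<^sup>2 + 2 * (f * (\<beta> + q)) * \<beta> * (\<beta> + q) + (f * (\<beta> + q))\<^sup>2 * \<gamma>"
      by (simp add: algebra_simps power2_eq_square)
    ultimately have "(\<alpha> + 2 * f * \<beta> + f\<^sup>2 * \<gamma>) * (\<beta> + q)\<^sup>2 = \<alpha> * (q\<^sup>2 - (\<beta>\<^sup>2 - \<alpha> * \<gamma>))"
      by (simp add: algebra_simps power2_eq_square)
    then show ?thesis
      using q(1) \<open>\<beta> + q \<noteq> 0\<close> by simp
  qed
  obtain S1 where S1: "Iwahori_congruent S S1"
    and S1_nth: "\<And>i j. S1 $ i $ j = S $ i $ j + (if j = r then f * S $ i $ c else 0) +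
      (if i = r then f * S $ c $ j else 0) + (if i = r \<and> j = r then f\<^sup>2 * S $ c $ c else 0)"
    using add_column[of c r f S] \<open>r < c\<close> f vge_mono[OF f, of 0] by auto
  define \<beta>' where "\<beta>' = \<beta> + f * \<gamma>"
  have f\<gamma>: "vge (m + 1) (f * \<gamma>)"
    using vge_mult[OF f cc] by (simp add: \<gamma>_def algebra_simps)
  then have \<beta>': "vge m \<beta>'" "\<beta>' $$ m \<noteq> 0"
    using rc vge_mono[OF f\<gamma>, of m] vge_nth_eq_0[OF f\<gamma>, of m]
    by (auto simp: \<beta>'_def \<beta>_def intro: vge_add)
  then have "\<beta>' \<noteq> 0"
    by auto
  have S1: "Iwahori_congruent S S1" "S1 $ r $ r = 0" "S1 $ r $ c = \<beta>'" "S1 $ c $ r = \<beta>'" "S1 $ c $ c = \<gamma>"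
    "\<And>i j. i \<notin> {r, c} \<or> j \<notin> {r, c} \<Longrightarrow> S1 $ i $ j = S $ i $ j"
    using S1 f_root \<open>r < c\<close> isolated isolated' \<beta>
    by (auto simp: S1_nth \<beta>'_def block_defs algebra_simps)
  \<comment> \<open>Column \<open>r\<close> is now isotropic, and adding \<open>h\<close> times it to column \<open>c\<close> makes that one isotropic too.\<close>
  define h where "h = - \<gamma> / (2 * \<beta>')"
  have "vge m (2 * \<beta>')" "(2 * \<beta>') $$ m \<noteq> 0"
    using vge_add[OF \<beta>'(1) \<beta>'(1)] \<beta>'(2) two by (simp_all only: mult_2 fls_plus_nth) (simp flip: mult_2)
  then have "vge 0 h"
    unfolding h_def using cc by (intro vge_divide[of m _ m]) (auto simp: \<gamma>_def vge_uminus)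
  then obtain S2 where S2: "Iwahori_congruent S1 S2"
    and S2_nth: "\<And>i j. S2 $ i $ j = S1 $ i $ j + (if j = c then h * S1 $ i $ r else 0) +
      (if i = c then h * S1 $ r $ j else 0) + (if i = c \<and> j = c then h\<^sup>2 * S1 $ r $ r else 0)"
    using add_column[of r c h S1] \<open>r < c\<close> by (metis less_asym less_irrefl)
  have "\<gamma> + h * \<beta>' + h * \<beta>' = 0"
    using two' \<open>\<beta>' \<noteq> 0\<close> by (simp add: h_def field_simps)
  then have S2: "Iwahori_congruent S1 S2" "S2 $ r $ r = 0" "S2 $ r $ c = \<beta>'" "S2 $ c $ r = \<beta>'" "S2 $ c $ c = 0"
    "\<And>i j. i \<notin> {r, c} \<or> j \<notin> {r, c} \<Longrightarrow> S2 $ i $ j = S $ i $ j"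
    using S2 \<open>r < c\<close> isolated isolated' S1 by (auto simp: S2_nth)
  define u where "u = fls_X powi m / \<beta>'"
  have "u * \<beta>' = fls_X powi m"
    using \<open>\<beta>' \<noteq> 0\<close> by (simp add: u_def)
  moreover have "vge 0 u"
    unfolding u_def using \<beta>' by (intro vge_divide[of m _ m]) (auto intro: vge_X_powi)
  ultimately have "u $$ 0 \<noteq> 0"
    using nth_mult_lowest[of 0 u m \<beta>'] \<beta>' by (auto simp: fls_X_powi_nth)
  with \<open>vge 0 u\<close> obtain S3 where S3: "Iwahori_congruent S2 S3"
    and S3_nth: "\<And>i j. S3 $ i $ j = (if i = r then u else 1) * (if j = r then u else 1) * S2 $ i $ j"
    using scale_column[of u S2 r] by blast
  show ?thesis
  proof (rule that)
    show "Iwahori_congruent S S3"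
      using S1(1) S2(1) S3 congruent_trans by blast
    show "S3 $ i $ j = S $ i $ j" if "i \<notin> {r, c} \<or> j \<notin> {r, c}" for i j
      using that S2(6)[OF that] isolated isolated' by (auto simp: S3_nth)
  qed (use S2 \<open>r < c\<close> \<open>u * \<beta>' = fls_X powi m\<close> in \<open>auto simp: S3_nth\<close>)
qed

text \<open>\<open>reduced_on D S\<close> says that the columns \<open>D\<close> of \<open>S\<close> look like those of an affine permutation
  matrix whose permutation maps \<open>D\<close> to itself.\<close>

definition reduced_on :: "'n set \<Rightarrow> 'k::field fls ^ 'n ^ 'n \<Rightarrow> bool"
  where "reduced_on D S \<longleftrightarrow>
    (\<forall>j\<in>D. \<exists>k\<in>D. \<exists>e. \<forall>i. S $ i $ j = (if i = k then fls_X powi e else 0))"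

lemma reduced_on_outside:
  assumes "reduced_on D S" "j \<in> D" "i \<notin> D"
  shows "S $ i $ j = 0"
  using assms unfolding reduced_on_def by metis

text \<open>The pivot \<open>(r, c)\<close> is an entry of least valuation \<open>m\<close> outside \<open>D\<close>, with \<open>r\<close> and then
  \<open>c\<close> as small as possible. By the minimality of the valuation, the multiples of the pivot columns
  needed to clear the other columns are integral; by the choice of \<open>r\<close> and \<open>c\<close>, those that are
  added to an earlier column are divisible by \<open>t\<close>.\<close>

lemma pivot_exists:
  fixes S :: "'k::field fls ^ 'n::{finite,linorder} ^ 'n::{finite,linorder}"
  assumes sym: "transpose S = S" and inv: "invertible S" and red: "reduced_on D S" and "D \<noteq> UNIV"
  obtains r c m where "r \<notin> D" "c \<notin> D" "r \<le> c" "S $ r $ c $$ m \<noteq> 0"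
    "\<And>i j. i \<notin> D \<Longrightarrow> j \<notin> D \<Longrightarrow> vge m (S $ i $ j)"
    "\<And>j. j \<notin> D \<Longrightarrow> j < c \<Longrightarrow> vge (m + 1) (S $ r $ j)"
    "\<And>i j. i \<notin> D \<Longrightarrow> j \<notin> D \<Longrightarrow> i < r \<Longrightarrow> vge (m + 1) (S $ i $ j)"
proof -
  define V where "V = (\<lambda>(i, j). fls_subdegree (S $ i $ j)) ` {(i, j). i \<notin> D \<and> j \<notin> D \<and> S $ i $ j \<noteq> 0}"
  obtain j where "j \<notin> D"
    using \<open>D \<noteq> UNIV\<close> by auto
  obtain S' where S': "S' ** S = mat 1"
    using inv by (auto simp: invertible_def)
  have "\<exists>i. S $ i $ j \<noteq> 0"
  proof (rule ccontr)
    assume "\<nexists>i. S $ i $ j \<noteq> 0"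
    then have "(S' ** S) $ j $ j = 0"
      by (simp add: matrix_mult_nth)
    then show False
      by (simp add: S' mat_1_nth)
  qed
  then obtain i where "S $ i $ j \<noteq> 0"
    by blast
  moreover from this have "i \<notin> D"
    using reduced_on_outside[OF red, of i j] \<open>j \<notin> D\<close> symmetric_nth[OF sym, of i j] by auto
  ultimately have "V \<noteq> {}"
    using \<open>j \<notin> D\<close> by (auto simp: V_def)
  have "finite V"
    by (simp add: V_def)
  define m where "m = Min V"
  have m: "vge m (S $ i $ j)" if "i \<notin> D" "j \<notin> D" for i j
    using that \<open>finite V\<close> by (auto simp: vge_iff_subdegree m_def V_def intro!: Min_le)
  define P where "P i j \<longleftrightarrow> i \<notin> D \<and> j \<notin> D \<and> S $ i $ j $$ m \<noteq> 0" for i j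
  have P_sym: "P i j \<longleftrightarrow> P j i" for i j
    using symmetric_nth[OF sym, of i j] by (auto simp: P_def)
  have not_P: "vge (m + 1) (S $ i $ j)" if "i \<notin> D" "j \<notin> D" "\<not> P i j" for i j
    using that m vge_Suc by (auto simp: P_def)
  have "m \<in> V"
    using \<open>finite V\<close> \<open>V \<noteq> {}\<close> by (simp add: m_def)
  then have "\<exists>i j. P i j"
    unfolding P_def V_def by (force dest: nth_fls_subdegree_nonzero)
  then have ne: "{i. \<exists>j. P i j} \<noteq> {}"
    by auto
  define r where "r = Min {i. \<exists>j. P i j}"
  have "\<exists>j. P r j"
    using Min_in[OF _ ne] by (auto simp: r_def)
  then have ne': "{j. P r j} \<noteq> {}"
    by auto
  have r_le: "r \<le> i" if "P i j" for i j
    using that by (auto simp: r_def intro!: Min_le)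
  define c where "c = Min {j. P r j}"
  have "P r c"
    using Min_in[OF _ ne'] by (auto simp: c_def)
  have c_le: "c \<le> j" if "P r j" for j
    using that by (auto simp: c_def intro!: Min_le)
  show ?thesis
  proof (rule that)
    show "r \<le> c"
      using \<open>P r c\<close> P_sym r_le by blast
    show "vge (m + 1) (S $ r $ j)" if "j \<notin> D" "j < c" for j
    proof -
      have "\<not> P r j"
        using that(2) c_le leD by blast
      then show ?thesis
        using that(1) \<open>P r c\<close> not_P[of r j] by (simp add: P_def)
    qed
    show "vge (m + 1) (S $ i $ j)" if "i \<notin> D" "j \<notin> D" "i < r" for i j
      using that r_le leD not_P by blast
  qed (use \<open>P r c\<close> m in \<open>auto simp: P_def\<close>)
qed

text \<open>One step adds to \<open>D\<close> the one or two indices of the pivot.\<close>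

lemma reduce_step:
  fixes S :: "'k::field fls ^ 'n::{finite,linorder} ^ 'n::{finite,linorder}"
  assumes two: "(2 :: 'k) \<noteq> 0" and quad_closed: "\<forall>x::'k. \<exists>y. y\<^sup>2 = x"
    and sym: "transpose S = S" and inv: "invertible S" and red: "reduced_on D S" and "D \<noteq> UNIV"
  obtains S' D' where "Iwahori_congruent S S'" "D \<subset> D'" "reduced_on D' S'"
proof -
  obtain r c m where rc: "r \<notin> D" "c \<notin> D" "r \<le> c" "S $ r $ c $$ m \<noteq> 0"
    and m: "\<And>i j. i \<notin> D \<Longrightarrow> j \<notin> D \<Longrightarrow> vge m (S $ i $ j)"
    and c_min: "\<And>j. j \<notin> D \<Longrightarrow> j < c \<Longrightarrow> vge (m + 1) (S $ r $ j)"
    and r_min: "\<And>i j. i \<notin> D \<Longrightarrow> j \<notin> D \<Longrightarrow> i < r \<Longrightarrow> vge (m + 1) (S $ i $ j)"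
    using pivot_exists[OF sym inv red \<open>D \<noteq> UNIV\<close>] by metis
  have outside: "S $ k $ j = 0" if "j \<in> D" "k \<notin> D" for k j
    using reduced_on_outside[OF red] that by blast
  have m': "vge m (S $ k $ j)" if "k \<notin> D" for k j
    using m outside that by (cases "j \<in> D") auto
  have c_min': "vge (m + 1) (S $ r $ j)" if "j < c" for j
    using c_min outside that rc by (cases "j \<in> D") auto
  have r_min': "vge (m + 1) (S $ k $ j)" if "j < r" "k \<notin> D" for k j
    using r_min[of j k] outside[of j k] that symmetric_nth[OF sym, of k j] by (cases "j \<in> D") auto
  show ?thesis
  proof (cases "r = c")
    case True
    define \<alpha> where "\<alpha> = S $ r $ r"
    have \<alpha>: "vge m \<alpha>" "\<alpha> $$ m \<noteq> 0"
      using m rc True by (auto simp: \<alpha>_def)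
    then have "\<alpha> \<noteq> 0"
      by auto
    define x where "x = (\<lambda>(k::'n) j. - S $ r $ j / \<alpha>)"
    have x_integral: "vge 0 (x k j)" for k j
      unfolding x_def using \<alpha> m' rc by (intro vge_divide[of m _ m]) (auto intro: vge_uminus)
    have x_upper: "vge 1 (x k j)" if "k \<in> {r}" "j < k" for k j
      unfolding x_def using \<alpha> c_min' True that
      by (intro vge_divide[of "m + 1" _ m]) (auto intro: vge_uminus)
    obtain S1 where S1: "Iwahori_congruent S S1" "\<And>j. j \<noteq> r \<Longrightarrow> S1 $ r $ j = 0" "S1 $ r $ r = \<alpha>"
      "\<And>i j. i \<noteq> r \<Longrightarrow> j \<noteq> r \<Longrightarrow> x r j = 0 \<Longrightarrow> S1 $ i $ j = S $ i $ j"
    proof (rule clear_block[of "{r}" x S])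
      show "S $ k $ j + (\<Sum>l\<in>{r}. S $ k $ l * x l j) = 0" if "k \<in> {r}" for k j
        using that \<open>\<alpha> \<noteq> 0\<close> by (simp add: x_def flip: \<alpha>_def)
    qed (use x_integral x_upper in \<open>auto simp: \<alpha>_def\<close>)
    have S1_sym: "S1 $ i $ j = S1 $ j $ i" for i j
      using S1(1) congruent_symmetric symmetric_nth sym by blast
    have S1_D: "S1 $ i $ j = S $ i $ j" if "j \<in> D" for i j
    proof (cases "i = r")
      case True
      then show ?thesis
        using that rc outside S1(2)[of j] by auto
    next
      case False
      then show ?thesis
        using that rc outside S1(4)[of i j] by (auto simp: x_def)
    qed
    define v where "v = fls_X powi m / \<alpha>"
    have v: "vge 0 v" "v * \<alpha> = fls_X powi m"
      using \<alpha> \<open>\<alpha> \<noteq> 0\<close> by (auto simp: v_def intro: vge_divide[of m _ m] vge_X_powi)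
    then have "v $$ 0 \<noteq> 0"
      using nth_mult_lowest[of 0 v m \<alpha>] \<alpha> by (auto simp: fls_X_powi_nth)
    moreover obtain y where "y\<^sup>2 = v $$ 0"
      using quad_closed by blast
    ultimately obtain u where u: "u\<^sup>2 = v" "vge 0 u" "u $$ 0 \<noteq> 0"
      using fls_sqrt_exists[OF two, of 0 v y] v(1)
      by (metis mult_zero_right power_zero_numeral)
    then obtain S2 where S2: "Iwahori_congruent S1 S2"
      and S2_nth: "\<And>i j. S2 $ i $ j = (if i = r then u else 1) * (if j = r then u else 1) * S1 $ i $ j"
      using scale_column[of u S1 r] by blast
    show ?thesis
    proof (rule that)
      show "Iwahori_congruent S S2"
        using S1(1) S2 congruent_trans by blast
      show "D \<subset> insert r D"
        using rc by auto
      have "S2 $ i $ r = (if i = r then fls_X powi m else 0)" for i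
        using S1(2)[of i] S1(3) S1_sym[of i r] v(2) u(1) by (auto simp: S2_nth power2_eq_square)
      moreover have "S2 $ i $ j = S $ i $ j" if "j \<in> D" for i j
        using that rc S1_D[of j] outside[of j r] by (auto simp: S2_nth)
      ultimately show "reduced_on (insert r D) S2"
        using red unfolding reduced_on_def by (auto; metis)
    qed
  next
    case False
    then have "r < c"
      using rc by simp
    define \<alpha> \<beta> \<gamma> where "\<alpha> = S $ r $ r" and "\<beta> = S $ r $ c" and "\<gamma> = S $ c $ c"
    have \<beta>: "S $ c $ r = \<beta>"
      using symmetric_nth[OF sym] by (simp add: \<beta>_def)
    have val: "vge (m + 1) \<alpha>" "vge m \<beta>" "\<beta> $$ m \<noteq> 0" "vge m \<gamma>"
      using c_min' \<open>r < c\<close> m rc by (auto simp: \<alpha>_def \<beta>_def \<gamma>_def)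
    define \<Delta> where "\<Delta> = \<alpha> * \<gamma> - \<beta>\<^sup>2"
    have \<alpha>\<gamma>: "vge (2 * m + 1) (\<alpha> * \<gamma>)"
      using vge_mult[OF val(1) val(4)] by (simp add: algebra_simps)
    have "vge (2 * m) (\<beta>\<^sup>2)" "\<beta>\<^sup>2 $$ (2 * m) \<noteq> 0"
      using vge_mult[OF val(2) val(2)] nth_mult_lowest[OF val(2) val(2)] val(3)
      by (simp_all add: power2_eq_square)
    then have \<Delta>: "vge (2 * m) \<Delta>" "\<Delta> $$ (2 * m) \<noteq> 0"
      using vge_mono[OF \<alpha>\<gamma>, of "2 * m"] by (auto intro: vge_diff simp: \<Delta>_def vge_nth_eq_0[OF \<alpha>\<gamma>])
    then have "\<Delta> \<noteq> 0"
      by auto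
    \<comment> \<open>Minus the inverse of the pivot block, applied to column \<open>j\<close> of the rows \<open>r\<close> and \<open>c\<close>. The
      determinant \<open>\<Delta>\<close> has valuation exactly \<open>2 m\<close> because \<open>\<alpha>\<close> has valuation greater than \<open>m\<close>.\<close>
    define x where "x k j = (if k = r then (\<beta> * S $ c $ j - \<gamma> * S $ r $ j) / \<Delta>
      else (\<beta> * S $ r $ j - \<alpha> * S $ c $ j) / \<Delta>)" for k j
    have x_integral: "vge 0 (x k j)" for k j
      unfolding x_def using \<Delta> m' rc val vge_mono[OF val(1), of m]
      by (auto intro!: vge_divide[of "2 * m" _ "2 * m"] vge_diff vge_mult_le[of m _ m])
    \<comment> \<open>Valuation \<open>m\<close> occurs in row \<open>r\<close> only from column \<open>c\<close> on, and in row \<open>c\<close> only from column \<open>r\<close> on.\<close>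
    have x_upper: "vge 1 (x k j)" if "k \<in> {r, c}" "j < k" for k j
    proof (cases "k = r")
      case True
      then show ?thesis
        unfolding x_def using \<Delta> rc val r_min' that
        by (auto intro!: vge_divide[of "2 * m + 1" _ "2 * m"] vge_diff vge_mult_le[of m _ "m + 1"])
    next
      case False
      then have "vge (2 * m + 1) (\<beta> * S $ r $ j)" "vge (2 * m + 1) (\<alpha> * S $ c $ j)"
        using vge_mult[OF val(2) c_min'[of j]] vge_mult[OF val(1) m'[of c j]] that rc
        by (auto simp: algebra_simps)
      then show ?thesis
        unfolding x_def using \<Delta> False by (auto intro!: vge_divide[of "2 * m + 1" _ "2 * m"] vge_diff)
    qed
    have x_solves: "S $ k $ j + (\<Sum>l\<in>{r, c}. S $ k $ l * x l j) = 0" if "k \<in> {r, c}" for k j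
    proof -
      have "S $ r $ j * \<Delta> + \<alpha> * (\<beta> * S $ c $ j - \<gamma> * S $ r $ j) + \<beta> * (\<beta> * S $ r $ j - \<alpha> * S $ c $ j) = 0"
        "S $ c $ j * \<Delta> + \<beta> * (\<beta> * S $ c $ j - \<gamma> * S $ r $ j) + \<gamma> * (\<beta> * S $ r $ j - \<alpha> * S $ c $ j) = 0"
        by (simp_all add: \<Delta>_def algebra_simps power2_eq_square)
      then show ?thesis
        using that \<open>\<Delta> \<noteq> 0\<close> \<open>r < c\<close> \<beta>
        by (auto simp: x_def add_divide_eq_iff simp flip: \<alpha>_def \<beta>_def \<gamma>_def) (simp_all add: field_simps)
    qed
    obtain S1 where S1: "Iwahori_congruent S S1"
      "\<And>k j. k \<in> {r, c} \<Longrightarrow> j \<notin> {r, c} \<Longrightarrow> S1 $ k $ j = 0"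
      "\<And>k l. k \<in> {r, c} \<Longrightarrow> l \<in> {r, c} \<Longrightarrow> S1 $ k $ l = S $ k $ l"
      "\<And>i j. i \<notin> {r, c} \<Longrightarrow> j \<notin> {r, c} \<Longrightarrow> (\<And>k. k \<in> {r, c} \<Longrightarrow> x k j = 0) \<Longrightarrow> S1 $ i $ j = S $ i $ j"
      using x_integral x_upper x_solves by (rule clear_block[of "{r, c}" x S]) auto
    have S1_D: "S1 $ i $ j = S $ i $ j" if "j \<in> D" for i j
    proof (cases "i \<in> {r, c}")
      case True
      then show ?thesis
        using that rc outside S1(2)[of i j] by (cases "j \<in> {r, c}") auto
    next
      case False
      then show ?thesis
        using that rc outside by (intro S1(4)) (auto simp: x_def)
    qed
    have "transpose S1 = S1"
      using S1(1) sym congruent_symmetric by blast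
    obtain S2 where S2: "Iwahori_congruent S1 S2"
      "S2 $ r $ r = 0" "S2 $ c $ c = 0" "S2 $ r $ c = fls_X powi m" "S2 $ c $ r = fls_X powi m"
      "\<And>i j. i \<notin> {r, c} \<or> j \<notin> {r, c} \<Longrightarrow> S2 $ i $ j = S1 $ i $ j"
    proof (rule normalize_plane[OF two \<open>transpose S1 = S1\<close> \<open>r < c\<close>, of m])
    qed (use S1 val in \<open>auto simp: \<alpha>_def \<beta>_def \<gamma>_def\<close>)
    have S1_sym: "S1 $ i $ j = S1 $ j $ i" for i j
      using \<open>transpose S1 = S1\<close> symmetric_nth by blast
    show ?thesis
    proof (rule that)
      show "Iwahori_congruent S S2"
        using S1(1) S2(1) congruent_trans by blast
      show "D \<subset> insert r (insert c D)"
        using rc by auto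
      have "S2 $ i $ r = (if i = c then fls_X powi m else 0)" for i
        using S2 S1(2)[of r i] S1_sym[of i r] \<open>r < c\<close> by (cases "i \<in> {r, c}") auto
      moreover have "S2 $ i $ c = (if i = r then fls_X powi m else 0)" for i
        using S2 S1(2)[of c i] S1_sym[of i c] \<open>r < c\<close> by (cases "i \<in> {r, c}") auto
      moreover have "S2 $ i $ j = S $ i $ j" if "j \<in> D" for i j
        using that rc S1_D[of j] S2(6)[of i j] by auto
      ultimately show "reduced_on (insert r (insert c D)) S2"
        using red unfolding reduced_on_def by (auto; metis)
    qed
  qed
qed

lemma congruent_reduced:
  fixes S :: "'k::field fls ^ 'n::{finite,linorder} ^ 'n::{finite,linorder}"
  assumes "(2 :: 'k) \<noteq> 0" "\<forall>x::'k. \<exists>y. y\<^sup>2 = x"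
    and "transpose S = S" "invertible S"
  obtains S' where "Iwahori_congruent S S'" "reduced_on UNIV S'"
proof -
  have "\<exists>S'. Iwahori_congruent S S' \<and> reduced_on UNIV S'" if "reduced_on D S" for D
    using that assms(3,4)
  proof (induction "card (- D)" arbitrary: D S rule: less_induct)
    case less
    show ?case
    proof (cases "D = UNIV")
      case True
      then show ?thesis
        using less congruent_refl by blast
    next
      case False
      then obtain S' D' where step: "Iwahori_congruent S S'" "D \<subset> D'" "reduced_on D' S'"
        using reduce_step[OF assms(1,2)] less.prems by metis
      have "card (- D') < card (- D)"
        using step(2) by (intro psubset_card_mono) auto
      then obtain S'' where "Iwahori_congruent S' S''" "reduced_on UNIV S''"
        using less step congruent_symmetric congruent_invertible by blast
      then show ?thesis
        using step(1) congruent_trans by blast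
    qed
  qed
  moreover have "reduced_on {} S"
    by (simp add: reduced_on_def)
  ultimately show ?thesis
    using that by blast
qed


section \<open>Symmetric affine permutation matrices\<close>

lemma apm_perm_perm_matrix: "apm_perm (perm_matrix p e :: 'k::field fls ^ 'n ^ 'n) = p"
  by (rule ext) (simp add: apm_perm_def perm_matrix_nth)

lemma apm_exp_perm_matrix: "apm_exp (perm_matrix p e :: 'k::field fls ^ 'n ^ 'n) = e"
  by (rule ext) (simp add: apm_exp_def apm_perm_perm_matrix perm_matrix_nth)

lemma affine_perm_matrixE:
  assumes "affine_perm_matrix w"
  obtains p e where "w = perm_matrix p e"
proof -
  have "\<exists>p e. (\<forall>r. w $ r $ c \<noteq> 0 \<longrightarrow> r = p) \<and> w $ p $ c = fls_X powi e" for c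
    using assms unfolding affine_perm_matrix_def monomial_matrix_def by metis
  then obtain p e where pe: "\<And>c r. w $ r $ c \<noteq> 0 \<Longrightarrow> r = p c" "\<And>c. w $ p c $ c = fls_X powi e c"
    by metis
  have "w = perm_matrix p e"
    using pe by (auto simp: vec_eq_iff perm_matrix_nth)
  then show ?thesis
    by (rule that)
qed

lemma symmetric_perm_matrix_iff:
  "transpose (perm_matrix p e :: 'k::field fls ^ 'n ^ 'n) = perm_matrix p e \<longleftrightarrow>
    (\<forall>j. p (p j) = j \<and> e (p j) = e j)"
proof
  assume sym: "transpose (perm_matrix p e :: 'k fls ^ 'n ^ 'n) = perm_matrix p e"
  show "\<forall>j. p (p j) = j \<and> e (p j) = e j"
  proof
    fix j
    show "p (p j) = j \<and> e (p j) = e j"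
      using symmetric_nth[OF sym, of "p j" j] by (auto simp: perm_matrix_nth split: if_splits)
  qed
next
  assume "\<forall>j. p (p j) = j \<and> e (p j) = e j"
  then show "transpose (perm_matrix p e :: 'k fls ^ 'n ^ 'n) = perm_matrix p e"
    by (auto simp: vec_eq_iff transpose_def perm_matrix_nth)
qed

lemma affine_perm_matrix_perm_matrix:
  assumes "\<And>j. p (p j) = j"
  shows "affine_perm_matrix (perm_matrix p e :: 'k::field fls ^ 'n ^ 'n)"
  unfolding affine_perm_matrix_def monomial_matrix_def perm_matrix_nth
  using assms by (auto intro: exI[of _ "p _"]) metis+

lemma eSymAPM_iff:
  "w \<in> eSymAPM \<longleftrightarrow> (\<exists>p e. w = perm_matrix p e \<and> (\<forall>j. p (p j) = j \<and> e (p j) = e j) \<and>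
    even (\<Sum>j\<in>UNIV. e j))"
proof
  assume w: "w \<in> eSymAPM"
  then obtain p e where pe: "w = perm_matrix p e"
    using affine_perm_matrixE by (auto simp: eSymAPM_def)
  with w show "\<exists>p e. w = perm_matrix p e \<and> (\<forall>j. p (p j) = j \<and> e (p j) = e j) \<and>
      even (\<Sum>j\<in>UNIV. e j)"
    by (auto simp: eSymAPM_def apm_exp_perm_matrix symmetric_perm_matrix_iff)
qed (auto simp: eSymAPM_def apm_exp_perm_matrix symmetric_perm_matrix_iff
      intro: affine_perm_matrix_perm_matrix)

lemma reduced_on_UNIV:
  assumes "reduced_on UNIV S"
  obtains p e where "S = perm_matrix p e"
proof -
  have "\<forall>j. \<exists>k e. \<forall>i. S $ i $ j = (if i = k then fls_X powi e else 0)"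
    using assms unfolding reduced_on_def by simp
  then obtain p e where "\<forall>j i. S $ i $ j = (if i = p j then fls_X powi e j else 0)"
    unfolding choice_iff by (elim exE)
  then have "S = perm_matrix p e"
    by (simp add: vec_eq_iff perm_matrix_nth)
  then show ?thesis
    by (rule that)
qed

lemma prod_fls_X_powi: "finite I \<Longrightarrow> (\<Prod>i\<in>I. fls_X powi e i) = (fls_X powi (\<Sum>i\<in>I. e i) :: 'k::field fls)"
  by (induction I rule: finite_induct) (simp_all add: power_int_add)

lemma subdegree_det_perm_matrix:
  assumes "\<And>j. p (p j) = j" "\<And>j. e (p j) = e j"
  shows "fls_subdegree (det (perm_matrix p e :: 'k::field fls ^ 'n ^ 'n)) = (\<Sum>j\<in>UNIV. e j)"
proof -
  let ?w = "perm_matrix p e :: 'k fls ^ 'n ^ 'n"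
  have "p permutes UNIV"
    using assms(1) by (intro bij_imp_permutes involuntory_imp_bij) auto
  have "(\<Prod>i\<in>UNIV. ?w $ i $ q i) = 0" if "q \<noteq> p" for q
  proof -
    obtain i where "q i \<noteq> p i"
      using \<open>q \<noteq> p\<close> by blast
    then have "i \<noteq> p (q i)"
      using assms(1) by metis
    then have "?w $ i $ q i = 0"
      by (simp add: perm_matrix_nth)
    then show ?thesis
      by (auto intro: prod_zero)
  qed
  then have "det ?w = (\<Sum>q\<in>{p}. of_int (sign q) * (\<Prod>i\<in>UNIV. ?w $ i $ q i))"
    unfolding det_def using \<open>p permutes UNIV\<close>
    by (intro sum.mono_neutral_right) auto
  also have "\<dots> = of_int (sign p) * fls_X powi (\<Sum>j\<in>UNIV. e j)"
    using assms by (simp add: perm_matrix_nth prod_fls_X_powi)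
  finally show ?thesis
    by (cases "sign p = 1") (auto simp: sign_def split: if_splits)
qed


section \<open>The matrices \<open>g\<^sub>w\<close>\<close>

text \<open>\<open>\<mu> c\<close> is the other index of the block of \<open>g\<^sub>w\<close> that contains \<open>c\<close>, or \<open>c\<close> itself for a block
  of size one. Such an involution \<open>\<mu>\<close> lets the Gram matrix of \<open>g\<^sub>w\<close> be computed block by block.\<close>

lemma block_partner_exists:
  fixes P :: "('n::{finite,linorder} \<times> 'n) set" and p :: "'n \<Rightarrow> 'n" and e :: "'n \<Rightarrow> int"
  assumes inv: "\<And>j. p (p j) = j" "\<And>j. e (p j) = e j"
    and pairing: "is_pairing {j. p j = j \<and> odd (e j)} P"
  shows "\<exists>\<mu>. (\<forall>c. \<mu> (\<mu> c) = c) \<and> (\<forall>c. p c = c \<longrightarrow> even (e c) \<longrightarrow> \<mu> c = c) \<and>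
    (\<forall>c. p c \<noteq> c \<longrightarrow> \<mu> c = p c) \<and>
    (\<forall>c r. p c = c \<longrightarrow> odd (e c) \<longrightarrow> ((c, r) \<in> P \<or> (r, c) \<in> P \<longleftrightarrow> r = \<mu> c)) \<and>
    (\<forall>c. p c = c \<longrightarrow> odd (e c) \<longrightarrow> p (\<mu> c) = \<mu> c \<and> odd (e (\<mu> c)) \<and> \<mu> c \<noteq> c)"
proof -
  define S where "S = {j. p j = j \<and> odd (e j)}"
  define Q where "Q c r \<longleftrightarrow> (c, r) \<in> P \<or> (r, c) \<in> P" for c r
  have P: "j \<in> S" "k \<in> S" "j < k" if "(j, k) \<in> P" for j k
    using pairing that unfolding is_pairing_def S_def by blast+
  have ex: "\<exists>!q. q \<in> P \<and> (c = fst q \<or> c = snd q)" if "c \<in> S" for c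
    using pairing that unfolding is_pairing_def S_def by blast
  have "\<exists>!r. Q c r" if "c \<in> S" for c
  proof -
    obtain q where q: "q \<in> P" "c = fst q \<or> c = snd q"
      using ex[OF \<open>c \<in> S\<close>] by blast
    then have "\<exists>r. Q c r"
      unfolding Q_def by (metis prod.collapse)
    moreover have "r = r'" if "Q c r" "Q c r'" for r r'
      using that ex[OF \<open>c \<in> S\<close>] P(3) unfolding Q_def
      by (metis fst_conv order_less_irrefl prod.inject snd_conv order_less_asym)
    ultimately show ?thesis
      by blast
  qed
  then obtain \<nu> where \<nu>: "\<And>c r. c \<in> S \<Longrightarrow> Q c r \<longleftrightarrow> r = \<nu> c"
    by metis
  have Q_S: "Q c r \<Longrightarrow> c \<in> S \<and> r \<in> S \<and> c \<noteq> r \<and> Q r c" for c r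
    using P unfolding Q_def by blast
  have \<nu>_S: "\<nu> c \<in> S \<and> \<nu> c \<noteq> c \<and> \<nu> (\<nu> c) = c" if "c \<in> S" for c
    using \<nu> Q_S that by metis
  define \<mu> where "\<mu> c = (if c \<in> S then \<nu> c else p c)" for c
  have p_S: "p c \<in> S \<longleftrightarrow> c \<in> S" for c
    using inv by (auto simp: S_def)
  show ?thesis
  proof (intro exI[of _ \<mu>] conjI allI impI)
    show "\<mu> (\<mu> c) = c" for c
      using \<nu>_S inv p_S by (simp add: \<mu>_def)
    show "(c, r) \<in> P \<or> (r, c) \<in> P \<longleftrightarrow> r = \<mu> c" if "p c = c" "odd (e c)" for c r
      using \<nu>[of c r] that by (simp add: \<mu>_def Q_def S_def)
    show "p (\<mu> c) = \<mu> c" "odd (e (\<mu> c))" "\<mu> c \<noteq> c" if "p c = c" "odd (e c)" for c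
      using \<nu>_S[of c] that by (simp_all add: \<mu>_def S_def)
  qed (auto simp: \<mu>_def S_def)
qed

text \<open>The scalar products of columns are computed inside the blocks. In a block of two odd
  fixed points the norms come from \<open>1 + s\<^sup>2 = t\<close>, and in the block of a 2-cycle both columns are
  isotropic because \<open>i\<^sup>2 = -1\<close>.\<close>

theorem transpose_g_matrix_mult:
  fixes im :: "'k::field" and s :: "'k fps"
    and w :: "'k fls ^ 'n::{finite,linorder} ^ 'n::{finite,linorder}"
  assumes two: "(2 :: 'k) \<noteq> 0" and im: "im\<^sup>2 = -1" and s: "s\<^sup>2 = fps_X - 1"
    and "w \<in> eSymAPM" and pairing: "is_pairing (odd_fixed_points w) P"
  shows "transpose (g_matrix im s P w) ** g_matrix im s P w = w"
proof -
  obtain p e where w: "w = perm_matrix p e" and inv: "\<And>j. p (p j) = j" "\<And>j. e (p j) = e j"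
    using \<open>w \<in> eSymAPM\<close> by (auto simp: eSymAPM_iff)
  have pairing': "is_pairing {j. p j = j \<and> odd (e j)} P"
    using pairing by (simp add: w odd_fixed_points_def apm_perm_perm_matrix apm_exp_perm_matrix)
  obtain \<mu> where \<mu>: "\<And>c. \<mu> (\<mu> c) = c" "\<And>c. p c = c \<Longrightarrow> even (e c) \<Longrightarrow> \<mu> c = c"
    "\<And>c. p c \<noteq> c \<Longrightarrow> \<mu> c = p c"
    "\<And>c r. p c = c \<Longrightarrow> odd (e c) \<Longrightarrow> (c, r) \<in> P \<or> (r, c) \<in> P \<longleftrightarrow> r = \<mu> c"
    "\<And>c. p c = c \<Longrightarrow> odd (e c) \<Longrightarrow> p (\<mu> c) = \<mu> c \<and> odd (e (\<mu> c)) \<and> \<mu> c \<noteq> c"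
    using block_partner_exists[of p e P, OF inv pairing'] by blast
  have P_less: "j < k" if "(j, k) \<in> P" for j k
    using pairing that unfolding is_pairing_def by blast
  define g where "g = g_matrix im s P w"
  define \<sigma> where "\<sigma> = fps_to_fls s"
  define \<iota> where "\<iota> = fls_const im"
  have \<sigma>: "\<sigma> * \<sigma> = fls_X - 1"
    using arg_cong[OF s, of fps_to_fls] by (simp add: \<sigma>_def power2_eq_square fls_times_fps_to_fls)
  have \<iota>: "\<iota> * \<iota> = -1"
  proof -
    have "\<iota> * \<iota> = fls_const (im * im)"
      by (simp add: \<iota>_def)
    also have "im * im = -1"
      using im by (simp add: power2_eq_square)
    finally show ?thesis
      by simp
  qed
  have two': "(2 :: 'k fls) \<noteq> 0"
    using two by (metis fls_const_numeral fls_const_0 fls_const_nonzero)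
  define T :: "int \<Rightarrow> 'k fls" where "T a = fls_X powi ((a - 1) div 2)" for a
  have T: "T a * (T a * fls_X) = fls_X powi a" if "odd a" for a
  proof -
    have "T a * (T a * fls_X) = fls_X powi ((a - 1) div 2 + ((a - 1) div 2 + 1))"
      by (subst power_int_add) (simp_all add: T_def power_int_add_1)
    also have "(a - 1) div 2 + ((a - 1) div 2 + 1) = a"
      using that by presburger
    finally show ?thesis .
  qed
  have even_powi: "fls_X powi (a div 2) * fls_X powi (a div 2) = (fls_X powi a :: 'k fls)" if "even a" for a
  proof -
    have "fls_X powi (a div 2) * fls_X powi (a div 2) = (fls_X powi (a div 2 + a div 2) :: 'k fls)"
      by (subst power_int_add) simp_all
    also have "a div 2 + a div 2 = a"
      using that by presburger
    finally show ?thesis .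
  qed
  have g: "g $ r $ c =
    (if p c = c \<and> even (e c) then (if r = c then fls_X powi (e c div 2) else 0)
     else if p c = c then
      (if r = c then T (e c)
       else if (c, r) \<in> P then T (e c) * \<sigma>
       else if (r, c) \<in> P then - \<sigma> * T (e c)
       else 0)
     else if c < p c then (if r = c then \<iota> else if r = p c then 1 else 0)
     else (if r = p c then - \<iota> * fls_X powi (e c) / 2 else if r = c then fls_X powi (e c) / 2 else 0))"
    for r c
    by (simp add: g_def g_matrix_def w apm_perm_perm_matrix apm_exp_perm_matrix Let_def T_def \<sigma>_def \<iota>_def)
  have support: "g $ r $ c = 0" if "r \<noteq> c" "r \<noteq> \<mu> c" for r c
    using that \<mu>(3)[of c] \<mu>(4)[of c r] by (auto simp: g)
  have gram: "(transpose g ** g) $ i $ j = (\<Sum>r\<in>{i, \<mu> i}. g $ r $ i * g $ r $ j)" for i j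
  proof -
    have "(transpose g ** g) $ i $ j = (\<Sum>r\<in>UNIV. g $ r $ i * g $ r $ j)"
      by (simp add: matrix_mult_nth transpose_def)
    also have "\<dots> = (\<Sum>r\<in>{i, \<mu> i}. g $ r $ i * g $ r $ j)"
      by (rule sum.mono_neutral_right) (auto simp: support)
    finally show ?thesis .
  qed
  have "(transpose g ** g) $ i $ j = w $ i $ j" for i j
  proof (cases "j = i \<or> j = \<mu> i")
    case False
    then have "i \<noteq> j" "i \<noteq> \<mu> j" "\<mu> i \<noteq> j" "\<mu> i \<noteq> \<mu> j"
      using \<mu>(1) by metis+
    then have "(transpose g ** g) $ i $ j = 0"
      by (auto simp: gram support intro!: sum.neutral)
    moreover have "i \<noteq> p j"
      using False \<mu>(3)[of i] inv(1) by metis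
    ultimately show ?thesis
      by (simp add: w perm_matrix_nth)
  next
    case True
    consider "p i = i" "even (e i)" | "p i = i" "odd (e i)" | "p i \<noteq> i"
      by blast
    then show ?thesis
    proof cases
      case 1
      then have "\<mu> i = i" "j = i"
        using \<mu>(2) True by auto
      then show ?thesis
        using 1 by (simp add: gram g w perm_matrix_nth even_powi)
    next
      case 2
      define k where "k = \<mu> i"
      have k: "p k = k" "odd (e k)" "k \<noteq> i" "(i, k) \<in> P \<or> (k, i) \<in> P"
        using \<mu>(4,5)[OF 2] by (simp_all add: k_def)
      have j_cases: "j = i \<or> j = k"
        using True by (simp add: k_def)
      have diag: "g $ i $ i = T (e i)" "g $ k $ k = T (e k)"
        using 2 k by (simp_all add: g)
      have norm: "T (e i) * T (e i) + T (e i) * T (e i) * (\<sigma> * \<sigma>) = fls_X powi (e i)"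
        unfolding \<sigma> using T[OF 2(2)] by (simp add: algebra_simps)
      have "(transpose g ** g) $ i $ j = T (e i) * g $ i $ j + g $ k $ i * g $ k $ j"
        using k diag by (simp add: gram flip: k_def)
      also have "\<dots> = (if j = i then fls_X powi (e i) else 0)"
      proof (cases "(i, k) \<in> P")
        case True
        then have "(k, i) \<notin> P"
          using P_less less_asym by blast
        then have "g $ k $ i = T (e i) * \<sigma>" "g $ i $ k = - \<sigma> * T (e k)"
          using True 2 k by (simp_all add: g)
        then show ?thesis
          using j_cases diag k(3) by (elim disjE) (simp_all add: algebra_simps flip: norm)
      next
        case False
        then have "(k, i) \<in> P"
          using k by blast
        then have "g $ k $ i = - \<sigma> * T (e i)" "g $ i $ k = T (e k) * \<sigma>"
          using False 2 k by (simp_all add: g)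
        then show ?thesis
          using j_cases diag k(3) by (elim disjE) (simp_all add: algebra_simps flip: norm)
      qed
      also have "\<dots> = w $ i $ j"
        using j_cases 2 k by (elim disjE) (simp_all add: w perm_matrix_nth)
      finally show ?thesis .
    next
      case 3
      define k where "k = p i"
      have k: "\<mu> i = k" "p k = i" "k \<noteq> i" "e k = e i" "p i = k"
        using 3 \<mu>(3) inv by (auto simp: k_def)
      have j_cases: "j = i \<or> j = k"
        using True k by simp
      define h :: "'k fls" where "h = fls_X powi (e i) / 2"
      have h: "h + h = fls_X powi (e i)"
        using two' by (simp add: h_def flip: mult_2)
      have \<iota>_mult: "\<iota> * (\<iota> * h) = - h" "\<iota> * h * \<iota> = - h" "\<iota> * h * (\<iota> * h) = - (h * h)"
      proof -
        have "\<iota> * (\<iota> * h) = (\<iota> * \<iota>) * h" "\<iota> * h * \<iota> = (\<iota> * \<iota>) * h" "\<iota> * h * (\<iota> * h) = (\<iota> * \<iota>) * (h * h)"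
          by (simp_all only: mult_ac)
        then show "\<iota> * (\<iota> * h) = - h" "\<iota> * h * \<iota> = - h" "\<iota> * h * (\<iota> * h) = - (h * h)"
          by (simp_all only: \<iota>) simp_all
      qed
      have "(transpose g ** g) $ i $ j = g $ i $ i * g $ i $ j + g $ k $ i * g $ k $ j"
        using k by (simp add: gram)
      also have "\<dots> = (if j = k then fls_X powi (e i) else 0)"
      proof (cases "i < k")
        case True
        then have "\<not> k < i"
          by simp
        with True have "g $ i $ i = \<iota>" "g $ k $ i = 1" "g $ i $ k = - (\<iota> * h)" "g $ k $ k = h"
          using k by (simp_all add: g h_def)
        then show ?thesis
          using j_cases k(3) by (elim disjE) (simp_all add: \<iota> \<iota>_mult h)
      next
        case False
        then have "k < i" "\<not> i < k"
          using k by simp_all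
        then have "g $ k $ k = \<iota>" "g $ i $ k = 1" "g $ k $ i = - (\<iota> * h)" "g $ i $ i = h"
          using k by (simp_all add: g h_def)
        then show ?thesis
          using j_cases k(3) by (elim disjE) (simp_all add: \<iota> \<iota>_mult h)
      qed
      also have "\<dots> = w $ i $ j"
        using j_cases k by (elim disjE) (simp_all add: w perm_matrix_nth)
      finally show ?thesis .
    qed
  qed
  then show ?thesis
    by (simp add: vec_eq_iff g_def)
qed


section \<open>Double cosets and symmetric matrices\<close>

lemma O_group_iff: "a \<in> O_group \<longleftrightarrow> transpose a ** a = mat 1"
  unfolding O_group_def GL_group_def invertible_def
  using matrix_left_right_inverse by blast

lemma matrix_mult_cancel:
  fixes A B M :: "'a::semiring_1 ^ 'n ^ 'n"
  assumes "A ** B = mat 1"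
  shows "M ** A ** B = M"
  using assms by (simp flip: matrix_mul_assoc)

lemma O_group_mult: "a \<in> O_group \<Longrightarrow> b \<in> O_group \<Longrightarrow> a ** b \<in> O_group"
  by (simp add: O_group_iff matrix_transpose_mul matrix_mul_assoc matrix_mult_cancel)

lemma O_group_transpose: "a \<in> O_group \<Longrightarrow> transpose a \<in> O_group"
  unfolding O_group_iff using matrix_left_right_inverse[of "transpose a" a] by simp

lemma double_coset_eqI:
  assumes a: "a \<in> O_group" and b: "b \<in> Iwahori" and "g' = a ** g ** b"
  shows "double_coset O_group g' Iwahori = double_coset O_group g Iwahori"
proof -
  have subset: "double_coset O_group (a ** g ** b) Iwahori \<subseteq> double_coset O_group g Iwahori"
    if "a \<in> O_group" "b \<in> Iwahori" for a b g :: "'a fls ^ 'b::{finite,linorder} ^ 'b::{finite,linorder}"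
  proof
    fix x assume "x \<in> double_coset O_group (a ** g ** b) Iwahori"
    then obtain h l where "h \<in> O_group" "l \<in> Iwahori" "x = h ** (a ** g ** b) ** l"
      by (auto simp: double_coset_def)
    then have "x = (h ** a) ** g ** (b ** l)" "h ** a \<in> O_group" "b ** l \<in> Iwahori"
      using that by (simp_all add: O_group_mult Iwahori_mult matrix_mul_assoc)
    then show "x \<in> double_coset O_group g Iwahori"
      by (auto simp: double_coset_def)
  qed
  obtain b' where b': "b' \<in> Iwahori" "b ** b' = mat 1"
    using Iwahori_inverse[OF b] by metis
  have "transpose a ** a = mat 1"
    using a by (simp add: O_group_iff)
  then have "transpose a ** g' ** b' = g"
    unfolding \<open>g' = a ** g ** b\<close>
    using b'(2) by (simp add: matrix_mul_assoc matrix_mult_cancel)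
  then show ?thesis
    using subset[OF a b, of g] subset[OF O_group_transpose[OF a] b'(1), of g'] \<open>g' = a ** g ** b\<close>
    by auto
qed

lemma double_coset_eqD:
  assumes "double_coset O_group g Iwahori = double_coset O_group g' Iwahori"
  obtains a b where "a \<in> O_group" "b \<in> Iwahori" "g' = a ** g ** b"
proof -
  have "mat 1 \<in> O_group"
    by (simp add: O_group_iff)
  then have "mat 1 ** g' ** mat 1 \<in> double_coset O_group g' Iwahori"
    unfolding double_coset_def using mat_1_in_Iwahori by blast
  then have "g' \<in> double_coset O_group g Iwahori"
    using assms by simp
  then obtain a b where "a \<in> O_group" "b \<in> Iwahori" "g' = a ** g ** b"
    unfolding double_coset_def by blast
  then show ?thesis
    by (rule that)
qed

lemma transpose_mult_orthogonal:
  fixes a g b :: "'k::field fls ^ 'n ^ 'n"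
  assumes "a \<in> O_group"
  shows "transpose (a ** g ** b) ** (a ** g ** b) = transpose b ** (transpose g ** g) ** b"
  using assms unfolding O_group_iff
  by (simp add: matrix_transpose_mul matrix_mul_assoc matrix_mult_cancel)

text \<open>The fibres of \<open>g \<mapsto> g\<^sup>T g\<close> on \<open>GL\<^sub>n(F)\<close> are the cosets \<open>O\<^sub>n(F) h\<close>.\<close>

lemma same_gram_matrix:
  fixes g h :: "'k::field fls ^ 'n ^ 'n"
  assumes "invertible g" "invertible h" "transpose g ** g = transpose h ** h"
  obtains a where "a \<in> O_group" "g = a ** h"
proof -
  obtain h' where h': "h ** h' = mat 1" "h' ** h = mat 1"
    using assms(2) by (auto simp: invertible_def)
  have "transpose (g ** h') ** (g ** h') = transpose h' ** (transpose g ** g) ** h'"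
    by (simp add: matrix_transpose_mul matrix_mul_assoc)
  also have "\<dots> = transpose (h ** h') ** (h ** h')"
    unfolding assms(3) by (simp add: matrix_transpose_mul matrix_mul_assoc)
  finally have "g ** h' \<in> O_group"
    by (simp add: O_group_iff h')
  moreover have "g = (g ** h') ** h"
    by (simp add: h' flip: matrix_mul_assoc)
  ultimately show ?thesis
    by (rule that)
qed

lemma invertible_of_gram:
  fixes g :: "'k::field fls ^ 'n ^ 'n"
  assumes "invertible (transpose g ** g)"
  shows "invertible g"
  using assms by (simp add: invertible_det_nz det_mul)

lemma eSymAPM_invertible:
  assumes "w \<in> eSymAPM"
  shows "invertible w"
proof -
  obtain p e where w: "w = perm_matrix p e" and inv: "\<And>j. p (p j) = j"
    using assms by (auto simp: eSymAPM_iff)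
  have "w ** perm_matrix p (\<lambda>j. - e (p j)) = mat 1"
    by (simp add: vec_eq_iff w mult_perm_matrix_nth perm_matrix_nth inv mat_1_nth flip: power_int_add)
  then show ?thesis
    using invertible_right_inverse by blast
qed

text \<open>The sum of the exponents of the resulting matrix is even because, up to sign, its determinant
  is a power of \<open>t\<close>, and it is the square of \<open>det (g b)\<close>.\<close>

lemma gram_congruent_eSymAPM:
  fixes g :: "'k::field fls ^ 'n::{finite,linorder} ^ 'n::{finite,linorder}"
  assumes "(2 :: 'k) \<noteq> 0" "\<forall>x::'k. \<exists>y. y\<^sup>2 = x" "invertible g"
  obtains b where "b \<in> Iwahori" "transpose (g ** b) ** (g ** b) \<in> eSymAPM"
proof -
  let ?S = "transpose g ** g"
  have "transpose ?S = ?S"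
    by (simp add: matrix_transpose_mul)
  moreover have "invertible ?S"
    using assms(3) by (simp add: invertible_mult invertible_transpose)
  ultimately obtain w where w: "Iwahori_congruent ?S w" "reduced_on UNIV w"
    using congruent_reduced[OF assms(1,2)] by blast
  then obtain b where b: "b \<in> Iwahori" "w = transpose b ** ?S ** b"
    by (auto simp: Iwahori_congruent_def)
  have w_gram: "w = transpose (g ** b) ** (g ** b)"
    by (simp add: b(2) matrix_transpose_mul matrix_mul_assoc)
  obtain p e where pe: "w = perm_matrix p e"
    using reduced_on_UNIV[OF w(2)] by blast
  have "transpose w = w"
    by (simp add: w_gram matrix_transpose_mul)
  then have inv: "\<And>j. p (p j) = j" "\<And>j. e (p j) = e j"
    by (simp_all add: pe symmetric_perm_matrix_iff)
  have "invertible (g ** b)"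
    using assms(3) b(1) by (simp add: invertible_mult Iwahori_imp_invertible)
  then have "det (g ** b) \<noteq> 0"
    by (simp add: invertible_det_nz)
  then have "fls_subdegree (det w) = 2 * fls_subdegree (det (g ** b))"
    unfolding w_gram by (simp add: det_mul[of "transpose (g ** b)"])
  then have "even (\<Sum>j\<in>UNIV. e j)"
    using subdegree_det_perm_matrix[of p e, where 'k = 'k] inv by (simp add: pe)
  then have "w \<in> eSymAPM"
    using pe inv by (auto simp: eSymAPM_iff)
  then show ?thesis
    using that b(1) w_gram by simp
qed

theorem corollary1p4:
  fixes im :: "'k::field"
    and s :: "'k fps"
    and P :: "'k fls ^ 'n::{finite,linorder} ^ 'n::{finite,linorder} \<Rightarrow> ('n \<times> 'n) set"
  assumes char_ne_2: "CHAR('k) \<noteq> 2"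
    and quad_closed: "\<forall>x::'k. \<exists>y. y ^ 2 = x"
    and im: "im ^ 2 = -1"
    and s: "s ^ 2 = fps_X - 1"
    and pairing: "\<forall>w\<in>eSymAPM. is_pairing (odd_fixed_points w) (P w)"
  shows "bij_betw (\<lambda>w. double_coset O_group (g_matrix im s (P w) w) Iwahori)
           eSymAPM (double_cosets O_group GL_group Iwahori)"
proof -
  have "\<not> CHAR('k) dvd 2"
    using char_ne_2 CHAR_not_1'[where 'a = 'k] two_is_prime_nat prime_nat_iff by auto
  then have two: "(2 :: 'k) \<noteq> 0"
    using of_nat_eq_0_iff_char_dvd[of 2, where 'a = 'k] by simp
  define G where "G w = g_matrix im s (P w) w" for w
  have gram: "transpose (G w) ** G w = w" if "w \<in> eSymAPM" for w
    unfolding G_def using transpose_g_matrix_mult[OF two im s that] pairing that by blast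
  have G_invertible: "invertible (G w)" if "w \<in> eSymAPM" for w
    using invertible_of_gram[of "G w"] gram[OF that] eSymAPM_invertible[OF that] by simp
  have "inj_on (\<lambda>w. double_coset O_group (G w) Iwahori) eSymAPM"
  proof (rule inj_onI)
    fix w w'
    assume w: "w \<in> eSymAPM" and w': "w' \<in> eSymAPM"
      and "double_coset O_group (G w) Iwahori = double_coset O_group (G w') Iwahori"
    then obtain a b where a: "a \<in> O_group" and b: "b \<in> Iwahori" and G_w': "G w' = a ** G w ** b"
      using double_coset_eqD by blast
    have "transpose (G w') ** G w' = transpose b ** (transpose (G w) ** G w) ** b"
      unfolding G_w' by (rule transpose_mult_orthogonal[OF a])
    then have congruence: "w' = transpose b ** w ** b"
      by (simp only: gram[OF w] gram[OF w'])
    obtain p e where pe: "w = perm_matrix p e" "\<And>j. p (p j) = j"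
      using w by (auto simp: eSymAPM_iff)
    obtain q f where qf: "w' = perm_matrix q f" "\<And>j. q (q j) = j"
      using w' by (auto simp: eSymAPM_iff)
    have "inj p" "inj q"
      using pe(2) qf(2) by (metis injI)+
    then show "w = w'"
      using congruent_perm_matrices_eq[of p q b f e] b congruence pe(1) qf(1) by auto
  qed
  moreover have "(\<lambda>w. double_coset O_group (G w) Iwahori) ` eSymAPM =
      double_cosets O_group GL_group Iwahori"
  proof (intro equalityI subsetI)
    fix X assume "X \<in> (\<lambda>w. double_coset O_group (G w) Iwahori) ` eSymAPM"
    then show "X \<in> double_cosets O_group GL_group Iwahori"
      using G_invertible by (auto simp: double_cosets_def GL_group_def)
  next
    fix X :: "('k fls ^ 'n::{finite,linorder} ^ 'n::{finite,linorder}) set"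
    assume "X \<in> double_cosets O_group GL_group Iwahori"
    then obtain g where g: "invertible g" "X = double_coset O_group g Iwahori"
      by (auto simp: double_cosets_def GL_group_def)
    obtain b where b: "b \<in> Iwahori" and w: "transpose (g ** b) ** (g ** b) \<in> eSymAPM"
      using gram_congruent_eSymAPM[OF two quad_closed g(1)] by blast
    define w where "w = transpose (g ** b) ** (g ** b)"
    have "invertible (g ** b)"
      using g(1) b by (simp add: invertible_mult Iwahori_imp_invertible)
    then obtain a where a: "a \<in> O_group" "G w = a ** (g ** b)"
      using same_gram_matrix[of "G w" "g ** b"] G_invertible[of w] gram[of w] w
      unfolding w_def by metis
    then have "double_coset O_group (G w) Iwahori = X"
      using double_coset_eqI[OF a(1) b, of "G w" g] g(2) by (simp add: matrix_mul_assoc)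
    then show "X \<in> (\<lambda>w. double_coset O_group (G w) Iwahori) ` eSymAPM"
      using w unfolding w_def by blast
  qed
  ultimately show ?thesis
    by (simp add: bij_betw_def G_def)
qed

end
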